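(* Let $n\ge 3$ and let $P$ be a centered cyclic hyperbolic $n$-gon with circumradius $R(P)$. Then $$\mathrm{Peri}(P)\;\leq\; 2n\,\sinh^{-1}\!\left(\sin(\pi/n)\,\sinh R(P)\right),$$ with equality if and only if $P$ is regular.
   Context: A hyperbolic $n$-gon is a polygon with $n$ geodesic sides in the hyperbolic plane of constant curvature $-1$; all of its vertices are assumed to lie in the hyperbolic plane (no ideal vertices). A polygon is cyclic if all its vertices lie on the same circle (its circumcircle); $R(P)$ denotes the (hyperbolic) radius of the circumcircle. A cyclic polygon $P$ is centered if the center of its circumcircle lies in the interior of $P$. $\mathrm{Peri}(P)$ is the sum of the hyperbolic lengths of the sides. A polygon is regular if all its sides are equal and all its interior angles are equal. *)

theory Defs
  imports "HOL-Analysis.Analysis"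
begin

text \<open>
  The hyperbolic plane of curvature \<open>-1\<close> is the Poincare unit disc with the metric
  \<open>4 \<bar>dz\<bar>\<^sup>2 / (1 - \<bar>z\<bar>\<^sup>2)\<^sup>2\<close>; \<open>hdist\<close> is the induced distance, meaningful on \<open>hplane\<close> only.
\<close>

definition hplane :: "complex set" where
  "hplane = {z. cmod z < 1}"

definition hdist :: "complex \<Rightarrow> complex \<Rightarrow> real" where
  "hdist z w = arcosh (1 + 2 * (cmod (z - w))\<^sup>2 / ((1 - (cmod z)\<^sup>2) * (1 - (cmod w)\<^sup>2)))"

text \<open>The hyperbolic plane is uniquely geodesic, so the geodesic segment between two points is
  the set of points at which the triangle inequality becomes an equality.\<close>

definition hsegment :: "complex \<Rightarrow> complex \<Rightarrow> complex set" where
  "hsegment z w = {u \<in> hplane. hdist z u + hdist u w = hdist z w}"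

definition hcircle :: "complex \<Rightarrow> real \<Rightarrow> complex set" where
  "hcircle c r = {z \<in> hplane. hdist c z = r}"

text \<open>The point at distance \<open>t\<close> from \<open>v\<close> on the geodesic ray from \<open>v\<close> with initial direction
  \<open>cis \<theta>\<close>: the image of the radial ray from the origin under the isometry
  \<open>z \<mapsto> (z + v) / (1 + cnj v * z)\<close>, which sends \<open>0\<close> to \<open>v\<close> and has the positive real
  derivative \<open>1 - \<bar>v\<bar>\<^sup>2\<close> at \<open>0\<close>. As the model is conformal, \<open>\<theta>\<close> measures hyperbolic angle at \<open>v\<close>.\<close>

definition hray :: "complex \<Rightarrow> real \<Rightarrow> real \<Rightarrow> complex" where
  "hray v \<theta> t =
     (let z = of_real (tanh (t / 2)) * cis \<theta> in (z + v) / (1 + cnj v * z))"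

text \<open>A polygon is given by the cyclic list of its vertices.\<close>

definition hvertex :: "complex list \<Rightarrow> nat \<Rightarrow> complex" where
  "hvertex P i = P ! (i mod length P)"

definition hside :: "complex list \<Rightarrow> nat \<Rightarrow> complex set" where
  "hside P i = hsegment (hvertex P i) (hvertex P (Suc i))"

definition hside_length :: "complex list \<Rightarrow> nat \<Rightarrow> real" where
  "hside_length P i = hdist (hvertex P i) (hvertex P (Suc i))"

definition hboundary :: "complex list \<Rightarrow> complex set" where
  "hboundary P = (\<Union>i<length P. hside P i)"

text \<open>Two different sides meet exactly in their common endpoints, so that \<open>hboundary P\<close> is a
  simple closed curve.\<close>

definition hpolygon :: "nat \<Rightarrow> complex list \<Rightarrow> bool" where
  "hpolygon n P \<longleftrightarrow>
     n \<ge> 3 \<and> length P = n \<and> set P \<subseteq> hplane \<and> distinct P \<and>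
     (\<forall>i<n. \<forall>j<n. i \<noteq> j \<longrightarrow>
        hside P i \<inter> hside P j =
        {hvertex P i, hvertex P (Suc i)} \<inter> {hvertex P j, hvertex P (Suc j)})"

text \<open>The interior is the bounded component of the complement of the boundary. The component is
  taken in the whole complex plane; this is the same as in \<open>hplane\<close>, since the unbounded
  component contains everything near and beyond the unit circle.\<close>

definition hinterior :: "complex list \<Rightarrow> complex set" where
  "hinterior P = inside (hboundary P)"

text \<open>The interior angle at a vertex is the angular measure of the set of directions
  pointing into the polygon; it exceeds \<open>pi\<close> at a reflex vertex.\<close>

definition hinterior_angle :: "complex list \<Rightarrow> nat \<Rightarrow> real" where
  "hinterior_angle P i =
     measure lborel {\<theta> \<in> {0..<2 * pi}.
       eventually (\<lambda>t. hray (hvertex P i) \<theta> t \<in> hinterior P) (at_right 0)}"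

definition hperimeter :: "complex list \<Rightarrow> real" where
  "hperimeter P = (\<Sum>i<length P. hside_length P i)"

definition hregular :: "complex list \<Rightarrow> bool" where
  "hregular P \<longleftrightarrow>
     (\<forall>i<length P. \<forall>j<length P.
        hside_length P i = hside_length P j \<and> hinterior_angle P i = hinterior_angle P j)"

definition hcyclic :: "complex list \<Rightarrow> bool" where
  "hcyclic P \<longleftrightarrow> (\<exists>c\<in>hplane. \<exists>r. set P \<subseteq> hcircle c r)"

text \<open>Three different points lie on at most one hyperbolic circle, so centre and radius below
  are unique for a cyclic polygon.\<close>

definition hcircumcenter :: "complex list \<Rightarrow> complex" where
  "hcircumcenter P = (THE c. c \<in> hplane \<and> (\<exists>r. set P \<subseteq> hcircle c r))"

definition hcircumradius :: "complex list \<Rightarrow> real" where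
  "hcircumradius P = (THE r. \<exists>c\<in>hplane. set P \<subseteq> hcircle c r)"

definition hcentered :: "complex list \<Rightarrow> bool" where
  "hcentered P \<longleftrightarrow> hcyclic P \<and> hcircumcenter P \<in> hinterior P"

end

theory Submission
  imports Defs
begin

text \<open>Move the circumcentre to the origin. In the Klein model the sides become Euclidean chords of a
  circle. As the sides do not cross, the vertices off a given side all lie on one side of it, and as
  the centre lies in the interior it lies on that side too; hence all central angles are positively
  oriented (or all negatively) and they sum to \<open>2 * pi\<close>. A side with central angle \<open>\<theta>\<close> has length
  \<open>2 * arsinh (sin (\<theta> / 2) * sinh R)\<close>, which is strictly concave in \<open>\<theta>\<close>, so Jensen's inequality
  gives the bound, with equality exactly for equal central angles. In that case a rotation about the
  centre permutes the vertices cyclically, so that the interior angles agree as well.\<close>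

section \<open>Motions of the Poincare disc\<close>

text \<open>\<open>hpolygon\<close> speaks only of intersections of sides, so the order of the
  vertices on the circle has to be extracted from it, without knowing the orientation. The tool is
  the affine function whose sign tells the two sides of a chord: on the circle it factors into sines
  of half central angles, and each statement about sides becomes positivity of a product of such
  sines. That the angles sum to \<open>2 * pi\<close>, and not to a larger multiple as in a star,
  holds because each is below \<open>pi\<close> and the chord condition keeps the proper partial
  sums from passing \<open>2 * pi\<close>. The interior enters only through the boundedness of the
  component of the centre and through its transport by motions. Interior angles are compared by a
  motion and never evaluated.\<close>

definition mob :: "complex \<Rightarrow> complex \<Rightarrow> complex" where
  "mob a z = (z + a) / (1 + cnj a * z)"

lemma mob_denom_nonzero:
  assumes "cmod a < 1" "cmod z < 1"
  shows "1 + cnj a * z \<noteq> 0"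
proof
  assume "1 + cnj a * z = 0"
  then have "cnj a * z = -1" by (simp add: add_eq_0_iff)
  then have "cmod a * cmod z = 1"
    by (metis complex_mod_cnj norm_minus_cancel norm_mult norm_one)
  moreover have "cmod a * cmod z < 1 * 1"
    using assms by (intro mult_strict_mono') auto
  ultimately show False by simp
qed

text \<open>The numerator identity makes the defect \<open>1 - (cmod z)\<^sup>2\<close> change by a
  factor. The same factors appear in \<open>mob_diff\<close>, so they cancel in the quotient that
  defines \<open>hdist\<close>.\<close>

lemma one_minus_norm_mob:
  assumes "cmod a < 1" "cmod z < 1"
  shows "1 - (cmod (mob a z))\<^sup>2 = (1 - (cmod a)\<^sup>2) * (1 - (cmod z)\<^sup>2) / (cmod (1 + cnj a * z))\<^sup>2"
proof -
  have nz: "(cmod (1 + cnj a * z))\<^sup>2 \<noteq> 0"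
    using mob_denom_nonzero[OF assms] by simp
  have "(cmod (1 + cnj a * z))\<^sup>2 - (cmod (z + a))\<^sup>2 = (1 - (cmod a)\<^sup>2) * (1 - (cmod z)\<^sup>2)"
    unfolding cmod_power2 by (simp add: algebra_simps power2_eq_square)
  then show ?thesis
    using nz by (simp add: mob_def norm_divide power_divide field_simps)
qed

lemma norm_mob_less:
  assumes "cmod a < 1" "cmod z < 1"
  shows "cmod (mob a z) < 1"
proof -
  have "(cmod a)\<^sup>2 < 1" "(cmod z)\<^sup>2 < 1"
    using assms by (simp_all add: abs_square_less_1)
  then have "0 < (1 - (cmod a)\<^sup>2) * (1 - (cmod z)\<^sup>2) / (cmod (1 + cnj a * z))\<^sup>2"
    using mob_denom_nonzero[OF assms] by simp
  then have "(cmod (mob a z))\<^sup>2 < 1"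
    using one_minus_norm_mob[OF assms] by simp
  then show ?thesis by (simp add: abs_square_less_1)
qed

lemma mob_diff:
  assumes "cmod a < 1" "cmod z < 1" "cmod w < 1"
  shows "mob a z - mob a w = of_real (1 - (cmod a)\<^sup>2) * (z - w) / ((1 + cnj a * z) * (1 + cnj a * w))"
proof -
  have "of_real (1 - (cmod a)\<^sup>2) = 1 - a * cnj a"
    by (simp only: of_real_diff of_real_1 complex_norm_square)
  then show ?thesis
    using mob_denom_nonzero[OF assms(1,2)] mob_denom_nonzero[OF assms(1,3)]
    by (simp add: mob_def divide_simps) (simp add: algebra_simps)
qed

lemma hdist_mob:
  assumes "cmod a < 1" "cmod z < 1" "cmod w < 1"
  shows "hdist (mob a z) (mob a w) = hdist z w"
proof -
  have p: "0 < 1 - (cmod a)\<^sup>2"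
    using assms by (simp_all add: abs_square_less_1)
  have d: "cmod (1 + cnj a * z) \<noteq> 0" "cmod (1 + cnj a * w) \<noteq> 0"
    using mob_denom_nonzero assms by auto
  have n: "(cmod (mob a z - mob a w))\<^sup>2 =
      (1 - (cmod a)\<^sup>2)\<^sup>2 * (cmod (z - w))\<^sup>2 / ((cmod (1 + cnj a * z))\<^sup>2 * (cmod (1 + cnj a * w))\<^sup>2)"
    unfolding mob_diff[OF assms] norm_divide norm_mult norm_of_real
    by (simp add: power_divide power_mult_distrib)
  have "(cmod (mob a z - mob a w))\<^sup>2 / ((1 - (cmod (mob a z))\<^sup>2) * (1 - (cmod (mob a w))\<^sup>2))
      = (cmod (z - w))\<^sup>2 / ((1 - (cmod z)\<^sup>2) * (1 - (cmod w)\<^sup>2))"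
    unfolding n one_minus_norm_mob[OF assms(1,2)] one_minus_norm_mob[OF assms(1,3)]
    using p d by (simp add: power2_eq_square)
  then show ?thesis
    unfolding hdist_def by (metis times_divide_eq_right)
qed

lemma mob_minus_mob:
  assumes "cmod a < 1" "cmod z < 1"
  shows "mob (-a) (mob a z) = z"
proof -
  let ?d = "1 + cnj a * z"
  have d: "?d \<noteq> 0" using mob_denom_nonzero[OF assms] .
  have a: "1 - a * cnj a \<noteq> 0"
    using mob_denom_nonzero[of a "-a"] assms by (simp add: mult.commute)
  have "mob a z - a = z * (1 - a * cnj a) / ?d" "1 - cnj a * mob a z = (1 - a * cnj a) / ?d"
    using d by (simp_all add: mob_def field_simps)
  then show ?thesis
    using a d by (simp add: mob_def[of "-a"])
qed

lemma mob_rotate: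
  assumes "cmod b = 1"
  shows "b * mob a z = mob (b * a) (b * z)"
proof -
  have "cnj b * b = 1"
    using assms complex_norm_square[of b] by (simp add: mult.commute)
  then show ?thesis
    by (simp add: mob_def algebra_simps)
qed

text \<open>The factor in front of \<open>z\<close> is a quotient of conjugates, hence a rotation.
  Since \<open>hray v\<close> is \<open>mob v\<close> applied to a radial ray, this rotation is the
  amount by which \<open>mob a\<close> turns directions at \<open>v\<close>.\<close>

lemma mob_mob:
  assumes "cmod a < 1" "cmod v < 1" "cmod z < 1"
  shows "mob a (mob v z) = mob (mob a v) ((1 + a * cnj v) / (1 + cnj a * v) * z)"
proof -
  have d1: "1 + cnj v * z \<noteq> 0" using mob_denom_nonzero assms by blast
  have d2: "1 + cnj a * v \<noteq> 0" using mob_denom_nonzero assms by blast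
  have d2': "1 + a * cnj v \<noteq> 0" using mob_denom_nonzero[OF assms(2,1)] by (simp add: mult.commute)
  have "mob a (mob v z) = (z + v + a * (1 + cnj v * z)) / ((1 + cnj v * z) + cnj a * (z + v))"
    using d1 by (simp add: mob_def divide_simps)
  also have "\<dots> = ((1 + a * cnj v) * z + (v + a)) / ((1 + cnj a * v) + (cnj v + cnj a) * z)"
    by (simp add: algebra_simps)
  also have "\<dots> = mob (mob a v) ((1 + a * cnj v) / (1 + cnj a * v) * z)"
  proof -
    have c: "cnj (mob a v) = (cnj v + cnj a) / (1 + a * cnj v)"
      by (simp add: mob_def)
    have n: "(1 + a * cnj v) / (1 + cnj a * v) * z + mob a v =
        ((1 + a * cnj v) * z + (v + a)) / (1 + cnj a * v)"
      by (simp only: mob_def add_divide_distrib[symmetric] times_divide_eq_left)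
    have "1 + cnj (mob a v) * ((1 + a * cnj v) / (1 + cnj a * v) * z) =
        ((1 + cnj a * v) + (cnj v + cnj a) * z) / (1 + cnj a * v)"
    proof -
      have "1 + p / r * (r / q * z) = (q + p * z) / q" if "q \<noteq> 0" "r \<noteq> 0" for p q r :: complex
        using that by (simp add: field_simps)
      from this[OF d2 d2'] show ?thesis unfolding c .
    qed
    then show ?thesis
      unfolding mob_def[of "mob a v"] n using d2 by simp
  qed
  finally show ?thesis .
qed

text \<open>A rotation followed by a translation is the normal form of an orientation-preserving
  isometry. Reflections are left out so that directions are always shifted by a constant
  angle.\<close>

definition hmotion :: "(complex \<Rightarrow> complex) \<Rightarrow> bool" where
  "hmotion T \<longleftrightarrow> (\<exists>a b. cmod a < 1 \<and> cmod b = 1 \<and> T = (\<lambda>z. mob a (b * z)))"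

lemma hmotion_mob: "cmod a < 1 \<Longrightarrow> hmotion (mob a)"
  unfolding hmotion_def by (intro exI[of _ a] exI[of _ 1]) auto

lemma hmotion_rotate: "cmod b = 1 \<Longrightarrow> hmotion (\<lambda>z. b * z)"
  unfolding hmotion_def by (intro exI[of _ 0] exI[of _ b]) (auto simp: mob_def)

lemma hmotion_hplane: "hmotion T \<Longrightarrow> z \<in> hplane \<Longrightarrow> T z \<in> hplane"
  by (auto simp: hmotion_def hplane_def norm_mult intro!: norm_mob_less)

lemma hdist_hmotion: "hmotion T \<Longrightarrow> z \<in> hplane \<Longrightarrow> w \<in> hplane \<Longrightarrow> hdist (T z) (T w) = hdist z w"
proof -
  assume "hmotion T" "z \<in> hplane" "w \<in> hplane"
  then obtain a b where ab: "cmod a < 1" "cmod b = 1" "T = (\<lambda>z. mob a (b * z))"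
    and zw: "cmod z < 1" "cmod w < 1"
    by (auto simp: hmotion_def hplane_def)
  have "hdist (T z) (T w) = hdist (b * z) (b * w)"
    unfolding ab(3) by (rule hdist_mob) (use ab zw in \<open>auto simp: norm_mult\<close>)
  also have "\<dots> = hdist z w"
    using ab(2) by (simp add: hdist_def norm_mult flip: right_diff_distrib)
  finally show ?thesis .
qed

lemma continuous_on_hmotion: "hmotion T \<Longrightarrow> continuous_on hplane T"
proof -
  assume "hmotion T"
  then obtain a b where ab: "cmod a < 1" "cmod b = 1" "T = (\<lambda>z. mob a (b * z))"
    by (auto simp: hmotion_def)
  have "1 + cnj a * (b * z) \<noteq> 0" if "z \<in> hplane" for z
    using that ab by (intro mob_denom_nonzero) (auto simp: hplane_def norm_mult)
  then show ?thesis
    unfolding ab(3) mob_def by (intro continuous_intros) auto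
qed

lemma hmotion_inverse:
  assumes "hmotion T"
  obtains T' where "hmotion T'" "\<And>z. z \<in> hplane \<Longrightarrow> T' (T z) = z" "\<And>z. z \<in> hplane \<Longrightarrow> T (T' z) = z"
proof -
  obtain a b where ab: "cmod a < 1" "cmod b = 1" "T = (\<lambda>z. mob a (b * z))"
    using assms by (auto simp: hmotion_def)
  have bb: "cnj b * b = 1" "b * cnj b = 1"
    using ab complex_norm_square[of b] by (simp_all add: mult.commute)
  define T' where "T' = (\<lambda>z. cnj b * mob (-a) z)"
  have "T' = (\<lambda>z. mob (- (cnj b * a)) (cnj b * z))"
    using mob_rotate[of "cnj b" "-a"] ab by (simp add: T'_def)
  then have "hmotion T'"
    using ab unfolding hmotion_def
    by (intro exI[of _ "- (cnj b * a)"] exI[of _ "cnj b"]) (simp add: norm_mult)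
  moreover have "T' (T z) = z" if "z \<in> hplane" for z
    using mob_minus_mob[of a "b * z"] that ab bb
    by (simp add: T'_def hplane_def norm_mult flip: mult.assoc)
  moreover have "T (T' z) = z" if "z \<in> hplane" for z
    using mob_minus_mob[of "-a" z] that ab bb
    by (simp add: T'_def hplane_def norm_mult flip: mult.assoc)
  ultimately show thesis by (rule that)
qed

lemma inj_on_hmotion: "hmotion T \<Longrightarrow> inj_on T hplane"
  by (metis hmotion_inverse inj_on_inverseI)

text \<open>\<open>\<gamma>\<close> is the angle by which \<open>T\<close> turns directions at
  \<open>v\<close>. It is normalised to one period because the measure argument shifts within one
  period.\<close>

lemma hmotion_mob_comp:
  assumes "hmotion T" "cmod v < 1"
  obtains \<gamma> where "0 \<le> \<gamma>" "\<gamma> < 2 * pi" "\<And>z. cmod z < 1 \<Longrightarrow> T (mob v z) = mob (T v) (cis \<gamma> * z)"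
proof -
  obtain a b where ab: "cmod a < 1" "cmod b = 1" "T = (\<lambda>z. mob a (b * z))"
    using assms by (auto simp: hmotion_def)
  define k where "k = (1 + a * cnj (b * v)) / (1 + cnj a * (b * v)) * b"
  have bv: "cmod (b * v) < 1" using ab assms by (simp add: norm_mult)
  have "cmod (1 + a * cnj (b * v)) = cmod (cnj (1 + a * cnj (b * v)))"
    by (simp only: complex_mod_cnj)
  also have "\<dots> = cmod (1 + cnj a * (b * v))" by simp
  finally have "cmod k = 1"
    using mob_denom_nonzero[OF ab(1) bv] ab(2) by (simp add: k_def norm_mult norm_divide)
  then have k: "k = cis (Arg2pi k)"
    using Arg2pi_eq[of k] by (simp add: cis_conv_exp)
  have "T (mob v z) = mob (T v) (k * z)" if "cmod z < 1" for z
    using mob_mob[OF ab(1) bv, of "b * z"] that ab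
    by (simp add: mob_rotate k_def norm_mult mult.assoc)
  with k show thesis by (metis that Arg2pi_ge_0 Arg2pi_lt_2pi)
qed

section \<open>Geodesic segments in the Klein model\<close>

text \<open>On radii this is the doubling formula that takes \<open>tanh (d / 2)\<close> to
  \<open>tanh d\<close>, with \<open>d\<close> the distance from the origin; geodesics become
  straight chords.\<close>

definition klein :: "complex \<Rightarrow> complex" where
  "klein z = (2 / (1 + (cmod z)\<^sup>2)) *\<^sub>R z"

text \<open>The smaller root of the quadratic equation for the radius, with the root moved to the
  denominator so that nothing is singular at \<open>0\<close>.\<close>

definition klein_inv :: "complex \<Rightarrow> complex" where
  "klein_inv k = k /\<^sub>R (1 + sqrt (1 - (cmod k)\<^sup>2))"

lemma norm_klein: "cmod (klein z) = 2 * cmod z / (1 + (cmod z)\<^sup>2)"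
proof -
  have "0 < 1 + (cmod z)\<^sup>2" by (simp add: add_pos_nonneg)
  then show ?thesis by (simp add: klein_def)
qed

lemma norm_klein_less:
  assumes "cmod z < 1"
  shows "cmod (klein z) < 1"
proof -
  have "0 < (1 - cmod z)\<^sup>2" using assms by simp
  then have "2 * cmod z < 1 + (cmod z)\<^sup>2" by (simp add: power2_eq_square algebra_simps)
  moreover have "0 < 1 + (cmod z)\<^sup>2" by (simp add: add_pos_nonneg)
  ultimately show ?thesis by (simp add: norm_klein)
qed

lemma klein_inv_klein:
  assumes "cmod z < 1"
  shows "klein_inv (klein z) = z"
proof -
  have p: "0 < 1 + (cmod z)\<^sup>2" by (simp add: add_pos_nonneg)
  have q: "(cmod z)\<^sup>2 < 1" using assms by (simp add: abs_square_less_1)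
  have "1 - (cmod (klein z))\<^sup>2 = ((1 - (cmod z)\<^sup>2) / (1 + (cmod z)\<^sup>2))\<^sup>2"
    using p unfolding norm_klein by (simp add: field_simps) (simp add: power2_eq_square algebra_simps)
  then have "1 + sqrt (1 - (cmod (klein z))\<^sup>2) = 1 + (1 - (cmod z)\<^sup>2) / (1 + (cmod z)\<^sup>2)"
    using p q by (simp add: real_sqrt_divide)
  also have "\<dots> = 2 / (1 + (cmod z)\<^sup>2)"
    using p by (simp add: field_simps)
  finally have *: "1 + sqrt (1 - (cmod (klein z))\<^sup>2) = 2 / (1 + (cmod z)\<^sup>2)" .
  have "inverse (2 / (1 + (cmod z)\<^sup>2)) * (2 / (1 + (cmod z)\<^sup>2)) = 1"
    using p by (intro left_inverse) simp
  then show ?thesis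
    unfolding klein_inv_def * unfolding klein_def by (simp only: scaleR_scaleR scaleR_one)
qed

lemma klein_klein_inv:
  assumes "cmod k < 1"
  shows "cmod (klein_inv k) < 1" "klein (klein_inv k) = k"
proof -
  define s where "s = sqrt (1 - (cmod k)\<^sup>2)"
  have q: "(cmod k)\<^sup>2 < 1" using assms by (simp add: abs_square_less_1)
  then have s: "0 < s" "s\<^sup>2 = 1 - (cmod k)\<^sup>2" by (simp_all add: s_def)
  have n: "cmod (klein_inv k) = cmod k / (1 + s)"
    using s(1) by (simp add: klein_inv_def s_def[symmetric] divide_inverse mult.commute)
  have "cmod k / (1 + s) < 1" using assms s(1) by simp
  then show "cmod (klein_inv k) < 1" using n by simp
  have k2: "(cmod k)\<^sup>2 = (1 - s) * (1 + s)" using s by (simp add: algebra_simps power2_eq_square)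
  have "1 + (cmod (klein_inv k))\<^sup>2 = 1 + (1 - s) / (1 + s)"
    unfolding n power_divide k2 using s(1) by (simp add: power2_eq_square)
  also have "\<dots> = 2 / (1 + s)"
    using s(1) by (simp add: field_simps)
  finally have *: "1 + (cmod (klein_inv k))\<^sup>2 = 2 / (1 + s)" .
  have "2 / (2 / (1 + s)) * inverse (1 + s) = 1"
    using s(1) by (simp add: field_simps)
  then show "klein (klein_inv k) = k"
    unfolding klein_def * unfolding klein_inv_def s_def[symmetric] by (simp only: scaleR_scaleR scaleR_one)
qed

lemma continuous_on_klein_inv: "continuous_on hplane klein_inv"
proof -
  have "1 + sqrt (1 - (cmod z)\<^sup>2) \<noteq> 0" if "z \<in> hplane" for z
  proof -
    have "(cmod z)\<^sup>2 < 1" using that by (simp add: abs_square_less_1 hplane_def)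
    then have "0 < sqrt (1 - (cmod z)\<^sup>2)" by simp
    then show ?thesis by linarith
  qed
  then show ?thesis
    unfolding klein_inv_def by (intro continuous_intros) auto
qed

section \<open>Geodesics through the origin, and reduction of the general case to them\<close>

lemma zero_in_closed_segment_iff:
  fixes a b :: "'a :: euclidean_space"
  shows "0 \<in> closed_segment a b \<longleftrightarrow> a \<bullet> b = - (norm a * norm b)"
proof -
  have "0 \<in> closed_segment a b \<longleftrightarrow> norm (a - b) = norm a + norm b"
    by (simp add: between_mem_segment[symmetric] between dist_norm)
  also have "\<dots> \<longleftrightarrow> (norm (a - b))\<^sup>2 = (norm a + norm b)\<^sup>2"
    by (simp add: power2_eq_iff_nonneg)
  also have "\<dots> \<longleftrightarrow> a \<bullet> b = - (norm a * norm b)"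
    unfolding dot_norm_neg power2_sum by auto
  finally show ?thesis .
qed

lemma zero_in_closed_segment_scaleR:
  fixes a b :: "'a :: euclidean_space"
  assumes "0 < r" "0 < s"
  shows "0 \<in> closed_segment (r *\<^sub>R a) (s *\<^sub>R b) \<longleftrightarrow> 0 \<in> closed_segment a b"
proof -
  have "r * (s * x) = - (r * (s * y)) \<longleftrightarrow> x = - y" for x y
    using assms by (metis mult_left_cancel mult_minus_right not_less_iff_gr_or_eq)
  then show ?thesis
    using assms by (simp add: zero_in_closed_segment_iff mult.assoc mult.left_commute)
qed

lemma cosh_hdist:
  assumes "cmod z < 1" "cmod w < 1"
  shows "cosh (hdist z w) = 1 + 2 * (cmod (z - w))\<^sup>2 / ((1 - (cmod z)\<^sup>2) * (1 - (cmod w)\<^sup>2))"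
    and "0 \<le> hdist z w"
proof -
  have "0 < 1 - (cmod z)\<^sup>2" "0 < 1 - (cmod w)\<^sup>2" using assms by (simp_all add: abs_square_less_1)
  then have "1 \<le> 1 + 2 * (cmod (z - w))\<^sup>2 / ((1 - (cmod z)\<^sup>2) * (1 - (cmod w)\<^sup>2))" by simp
  then show "cosh (hdist z w) = 1 + 2 * (cmod (z - w))\<^sup>2 / ((1 - (cmod z)\<^sup>2) * (1 - (cmod w)\<^sup>2))"
      "0 \<le> hdist z w"
    by (simp_all add: hdist_def)
qed

lemma hdist_commute: "hdist z w = hdist w z"
  by (simp add: hdist_def norm_minus_commute mult.commute)

lemma cosh_sinh_hdist_0:
  assumes "cmod z < 1"
  shows "cosh (hdist 0 z) = (1 + (cmod z)\<^sup>2) / (1 - (cmod z)\<^sup>2)"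
    and "sinh (hdist 0 z) = 2 * cmod z / (1 - (cmod z)\<^sup>2)"
proof -
  have q: "0 < 1 - (cmod z)\<^sup>2" using assms by (simp add: abs_square_less_1)
  show c: "cosh (hdist 0 z) = (1 + (cmod z)\<^sup>2) / (1 - (cmod z)\<^sup>2)"
    using cosh_hdist(1)[of 0 z] assms q by (simp add: field_simps)
  have "(sinh (hdist 0 z))\<^sup>2 = (2 * cmod z / (1 - (cmod z)\<^sup>2))\<^sup>2"
    unfolding sinh_square_eq c using q by (simp add: field_simps) (simp add: power2_eq_square algebra_simps)
  then show "sinh (hdist 0 z) = 2 * cmod z / (1 - (cmod z)\<^sup>2)"
  proof (rule power2_eq_imp_eq)
    show "0 \<le> sinh (hdist 0 z)" using cosh_hdist(2)[of 0 z] assms by simp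
    show "0 \<le> 2 * cmod z / (1 - (cmod z)\<^sup>2)" using q by simp
  qed
qed

text \<open>Since \<open>cosh\<close> is injective on nonnegative reals, equality in the hyperbolic
  triangle inequality can be tested after applying \<open>cosh\<close>. With denominators cleared,
  it says that \<open>z\<close> and \<open>w\<close> point in opposite directions, which is also the
  Euclidean condition.\<close>

lemma zero_in_hsegment_iff:
  assumes "cmod z < 1" "cmod w < 1"
  shows "0 \<in> hsegment z w \<longleftrightarrow> 0 \<in> closed_segment z w"
proof -
  have p: "0 < 1 - (cmod z)\<^sup>2" "0 < 1 - (cmod w)\<^sup>2" using assms by (simp_all add: abs_square_less_1)
  have "0 \<in> hsegment z w \<longleftrightarrow> hdist 0 z + hdist 0 w = hdist z w"
    by (simp add: hsegment_def hplane_def hdist_commute[of z 0])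
  also have "\<dots> \<longleftrightarrow> cosh (hdist 0 z + hdist 0 w) = cosh (hdist z w)"
    using cosh_hdist(2) assms by (metis add_nonneg_nonneg arcosh_cosh_real norm_zero zero_less_one)
  also have "\<dots> \<longleftrightarrow> (1 + (cmod z)\<^sup>2) * (1 + (cmod w)\<^sup>2) + 4 * (cmod z * cmod w) =
      (1 - (cmod z)\<^sup>2) * (1 - (cmod w)\<^sup>2) + 2 * (cmod (z - w))\<^sup>2"
  proof -
    have "a / p * (b / q) + 2 * x / p * (2 * y / q) = 1 + 2 * X / (p * q) \<longleftrightarrow>
        a * b + 4 * (x * y) = p * q + 2 * X" if "0 < p" "0 < q" for a b p q x y X :: real
    proof -
      have "a / p * (b / q) + 2 * x / p * (2 * y / q) = (a * b + 4 * (x * y)) / (p * q)"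
        "1 + 2 * X / (p * q) = (p * q + 2 * X) / (p * q)"
        using that by (simp_all add: add_divide_distrib)
      then show ?thesis using that by simp
    qed
    from this[OF p] show ?thesis
      unfolding cosh_add cosh_sinh_hdist_0[OF assms(1)] cosh_sinh_hdist_0[OF assms(2)] cosh_hdist(1)[OF assms] .
  qed
  also have "\<dots> \<longleftrightarrow> z \<bullet> w = - (cmod z * cmod w)"
    unfolding dot_norm_neg by (auto simp: algebra_simps)
  also have "\<dots> \<longleftrightarrow> 0 \<in> closed_segment z w"
    by (simp add: zero_in_closed_segment_iff)
  finally show ?thesis .
qed

text \<open>Moving \<open>u\<close> to the origin, \<open>mob (-u) z\<close> is a positive multiple of \<open>L (klein z)\<close> with the
  real affine map \<open>L k = k + u\<^sup>2 * cnj k - 2 * u\<close>, whose only zero is \<open>klein u\<close>.\<close>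

lemma hsegment_iff_klein:
  assumes z: "cmod z < 1" and w: "cmod w < 1" and u: "cmod u < 1"
  shows "u \<in> hsegment z w \<longleftrightarrow> klein u \<in> closed_segment (klein z) (klein w)"
proof -
  define f where "f k = k + u\<^sup>2 * cnj k" for k
  define L where "L k = f k - 2 * u" for k
  have lin: "linear f"
    by (intro linearI) (auto simp: f_def algebra_simps scaleR_conv_of_real)
  have pos: "\<exists>r>0. mob (-u) x = r *\<^sub>R L (klein x)" if x: "cmod x < 1" for x
  proof (intro exI conjI)
    let ?d = "cmod (1 - cnj u * x)"
    have d: "1 - cnj u * x \<noteq> 0" using mob_denom_nonzero[of "-u" x] u x by simp
    have p: "0 < 1 + (cmod x)\<^sup>2" by (simp add: add_pos_nonneg)
    then show "0 < (1 + (cmod x)\<^sup>2) / 2 / ?d\<^sup>2" using d by simp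
    have "((1 + (cmod x)\<^sup>2) / 2) *\<^sub>R klein x = x"
    proof -
      have "(1 + (cmod x)\<^sup>2) / 2 * (2 / (1 + (cmod x)\<^sup>2)) = 1"
        using p by (simp add: field_simps)
      then show ?thesis by (simp only: klein_def scaleR_scaleR scaleR_one)
    qed
    then have "((1 + (cmod x)\<^sup>2) / 2) *\<^sub>R f (klein x) = x + u\<^sup>2 * cnj x"
      using linear_scale[OF lin, of "(1 + (cmod x)\<^sup>2) / 2" "klein x"] by (simp only: f_def)
    then have "((1 + (cmod x)\<^sup>2) / 2) *\<^sub>R L (klein x) = x + u\<^sup>2 * cnj x - u * of_real (1 + (cmod x)\<^sup>2)"
      unfolding L_def scaleR_diff_right by (simp add: scaleR_conv_of_real)
    also have "\<dots> = (x - u) * (1 - u * cnj x)"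
      unfolding of_real_add of_real_1 complex_norm_square by (simp add: algebra_simps power2_eq_square)
    finally have "(1 / ?d\<^sup>2) *\<^sub>R ((1 + (cmod x)\<^sup>2) / 2) *\<^sub>R L (klein x) = (x - u) * (1 - u * cnj x) / of_real (?d\<^sup>2)"
      by (simp add: scaleR_conv_of_real)
    also have "\<dots> = mob (-u) x"
    proof -
      have e: "of_real (?d\<^sup>2) = (1 - cnj u * x) * (1 - u * cnj x)"
        by (simp only: complex_norm_square) simp
      have "1 - u * cnj x \<noteq> 0" using d by (metis complex_cnj_cnj complex_cnj_diff complex_cnj_mult complex_cnj_one complex_cnj_zero_iff)
      then show ?thesis unfolding e mob_def using d by simp
    qed
    finally show "mob (-u) x = ((1 + (cmod x)\<^sup>2) / 2 / ?d\<^sup>2) *\<^sub>R L (klein x)"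
      by (simp add: mult.commute)
  qed
  have inj: "f k = 0 \<Longrightarrow> k = 0" for k
  proof (rule ccontr)
    assume "f k = 0" "k \<noteq> 0"
    then have "k = - (u\<^sup>2 * cnj k)" by (simp add: f_def eq_neg_iff_add_eq_0)
    then have "cmod k = (cmod u)\<^sup>2 * cmod k"
      by (metis complex_mod_cnj norm_minus_cancel norm_mult norm_power)
    with \<open>k \<noteq> 0\<close> have "(cmod u)\<^sup>2 = 1" by simp
    with u show False by (metis abs_norm_cancel abs_square_less_1 less_irrefl)
  qed
  \<comment> \<open>\<open>mob (-u) u\<close> is \<open>0\<close> and a positive multiple of
    \<open>L (klein u)\<close>, so \<open>L\<close> vanishes there.\<close>
  have ku: "f (klein u) = 2 * u"
    using pos[OF u] by (auto simp: L_def mob_def)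
  obtain r s where rs: "0 < r" "mob (-u) z = r *\<^sub>R L (klein z)" "0 < s" "mob (-u) w = s *\<^sub>R L (klein w)"
    using pos[OF z] pos[OF w] by auto
  have m: "cmod (-u) < 1" using u by simp
  have m0: "mob (-u) u = 0" by (simp add: mob_def)
  have "u \<in> hsegment z w \<longleftrightarrow> 0 \<in> hsegment (mob (-u) z) (mob (-u) w)"
    using hdist_mob[OF m u z] hdist_mob[OF m u w] hdist_mob[OF m z w] u
    by (simp add: hsegment_def hplane_def m0 hdist_commute[of _ 0] hdist_commute[of z u])
  also have "\<dots> \<longleftrightarrow> 0 \<in> closed_segment (mob (-u) z) (mob (-u) w)"
    by (intro zero_in_hsegment_iff norm_mob_less m z w)
  \<comment> \<open>The two endpoints are rescaled by different positive factors, which moves the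
    segment but does not affect whether it contains \<open>0\<close>.\<close>
  also have "\<dots> \<longleftrightarrow> 0 \<in> closed_segment (L (klein z)) (L (klein w))"
    using rs by (simp add: zero_in_closed_segment_scaleR)
  also have "\<dots> \<longleftrightarrow> 2 * u \<in> closed_segment (f (klein z)) (f (klein w))"
    using closed_segment_translation_eq[of "-2 * u" "2 * u" "f (klein z)" "f (klein w)"]
    by (simp add: L_def)
  also have "\<dots> \<longleftrightarrow> f (klein u) \<in> f ` closed_segment (klein z) (klein w)"
    by (simp add: ku closed_segment_linear_image[OF lin])
  also have "\<dots> \<longleftrightarrow> klein u \<in> closed_segment (klein z) (klein w)"
    using lin inj by (simp add: inj_image_mem_iff linear_injective_0)
  finally show ?thesis .
qed

lemma hsegment_eq_image:
  assumes "cmod z < 1" "cmod w < 1"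
  shows "hsegment z w = klein_inv ` closed_segment (klein z) (klein w)"
    and "closed_segment (klein z) (klein w) \<subseteq> hplane"
proof -
  show s: "closed_segment (klein z) (klein w) \<subseteq> hplane"
    using closed_segment_subset[of "klein z" "ball 0 1" "klein w"] norm_klein_less assms
    by (auto simp: hplane_def)
  show "hsegment z w = klein_inv ` closed_segment (klein z) (klein w)" (is "?A = ?B")
  proof
    show "?A \<subseteq> ?B"
    proof
      fix u assume u: "u \<in> ?A"
      then have "cmod u < 1" by (simp add: hsegment_def hplane_def)
      then show "u \<in> ?B"
        using hsegment_iff_klein[OF assms] u klein_inv_klein by (metis image_eqI)
    qed
    show "?B \<subseteq> ?A"
      using s hsegment_iff_klein[OF assms] klein_klein_inv by (auto simp: hplane_def subset_iff)
  qed
qed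

lemma compact_hsegment:
  assumes "cmod z < 1" "cmod w < 1"
  shows "compact (hsegment z w)"
  unfolding hsegment_eq_image(1)[OF assms]
  by (intro compact_continuous_image compact_segment
      continuous_on_subset[OF continuous_on_klein_inv hsegment_eq_image(2)[OF assms]])

section \<open>Motions and polygons\<close>

text \<open>A component of the complement of \<open>S\<close> that starts in \<open>A\<close> cannot
  cross the frontier of \<open>A\<close>, so it stays in \<open>A\<close> and is bounded.\<close>

lemma bounded_subset_inside:
  fixes A S :: "'a :: real_normed_vector set"
  assumes "bounded A" "A \<inter> S = {}" "frontier A \<subseteq> S"
  shows "A \<subseteq> inside S"
proof
  fix x assume x: "x \<in> A"
  let ?C = "connected_component_set (- S) x"
  have xC: "x \<in> ?C" using x assms(2) by (auto intro: connected_component_refl)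
  have "?C \<inter> frontier A = {}"
    using assms(3) connected_component_subset[of "- S" x] by blast
  then have "?C \<subseteq> A"
    using connected_Int_frontier[OF connected_connected_component, of _ x A] x xC by blast
  then show "x \<in> inside S"
    using x assms(1,2) bounded_subset by (auto simp: inside_def)
qed

lemma hplane_eq_ball: "hplane = ball 0 1"
  by (auto simp: hplane_def)

lemma inside_subset_hplane: "S \<subseteq> hplane \<Longrightarrow> inside S \<subseteq> hplane"
proof
  fix x assume S: "S \<subseteq> hplane" and x: "x \<in> inside S"
  have "x \<notin> outside S" using x inside_Int_outside[of S] by blast
  then show "x \<in> hplane"
    using outside_subset_convex[OF convex_ball[of 0 1], of S] S by (auto simp: hplane_eq_ball subset_iff)
qed

lemma image_inside_subset:
  assumes T: "hmotion T" and S: "compact S" "S \<subseteq> hplane"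
  shows "T ` inside S \<subseteq> inside (T ` S)"
proof (rule bounded_subset_inside)
  obtain T' where T': "hmotion T'" "\<And>z. z \<in> hplane \<Longrightarrow> T' (T z) = z" "\<And>z. z \<in> hplane \<Longrightarrow> T (T' z) = z"
    using hmotion_inverse[OF T] by blast
  have cS: "closed S" using S(1) by (rule compact_imp_closed)
  have I: "inside S \<subseteq> hplane" by (rule inside_subset_hplane[OF S(2)])
  have img: "T ` inside S \<subseteq> hplane" using I hmotion_hplane[OF T] by blast
  then show "bounded (T ` inside S)" using bounded_subset[of hplane] by (simp add: hplane_eq_ball)
  show disj: "T ` inside S \<inter> T ` S = {}"
    using inj_on_image_Int[OF inj_on_hmotion[OF T] I S(2)] by simp
  have "T ` inside S = hplane \<inter> T' -` inside S"
  proof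
    show "T ` inside S \<subseteq> hplane \<inter> T' -` inside S" using img I T'(2) by auto
    show "hplane \<inter> T' -` inside S \<subseteq> T ` inside S" using T'(3) by (force intro: rev_image_eqI)
  qed
  then have op: "open (T ` inside S)"
    using continuous_open_preimage[OF continuous_on_hmotion[OF T'(1)] _ open_inside[OF cS]] by (simp add: hplane_eq_ball)
  have "compact (S \<union> inside S)"
  proof -
    have "bounded (S \<union> inside S)" using S(1) by (simp add: compact_imp_bounded bounded_inside)
    moreover have "closed (S \<union> inside S)"
      by (simp add: union_with_inside closed_Compl open_outside cS)
    ultimately show ?thesis by (simp add: compact_eq_bounded_closed)
  qed
  then have "compact (T ` (S \<union> inside S))"
    using S(2) I by (intro compact_continuous_image continuous_on_subset[OF continuous_on_hmotion[OF T]]) auto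
  then have "closure (T ` inside S) \<subseteq> T ` (S \<union> inside S)"
    by (intro closure_minimal compact_imp_closed) auto
  then show "frontier (T ` inside S) \<subseteq> T ` S"
    using op by (auto simp: frontier_def interior_open)
qed

lemma inside_hmotion_image:
  assumes T: "hmotion T" and S: "compact S" "S \<subseteq> hplane"
  shows "inside (T ` S) = T ` inside S"
proof
  show "T ` inside S \<subseteq> inside (T ` S)" by (rule image_inside_subset[OF assms])
  obtain T' where T': "hmotion T'" "\<And>z. z \<in> hplane \<Longrightarrow> T' (T z) = z" "\<And>z. z \<in> hplane \<Longrightarrow> T (T' z) = z"
    using hmotion_inverse[OF T] by blast
  have TS: "compact (T ` S)" "T ` S \<subseteq> hplane"
    using S hmotion_hplane[OF T]
    by (auto intro!: compact_continuous_image continuous_on_subset[OF continuous_on_hmotion[OF T]])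
  have "T' ` T ` S = S" using T'(2) S(2) by (force simp: image_image)
  then have "T' ` inside (T ` S) \<subseteq> inside S"
    using image_inside_subset[OF T'(1) TS] by simp
  then have "T ` T' ` inside (T ` S) \<subseteq> T ` inside S" by blast
  moreover have "T ` T' ` inside (T ` S) = inside (T ` S)"
    using T'(3) inside_subset_hplane[OF TS(2)] by (force simp: image_image)
  ultimately show "inside (T ` S) \<subseteq> T ` inside S" by simp
qed

lemma hsegment_hmotion:
  assumes T: "hmotion T" and zw: "z \<in> hplane" "w \<in> hplane"
  shows "hsegment (T z) (T w) = T ` hsegment z w"
proof -
  obtain T' where T': "hmotion T'" "\<And>z. z \<in> hplane \<Longrightarrow> T' (T z) = z" "\<And>z. z \<in> hplane \<Longrightarrow> T (T' z) = z"
    using hmotion_inverse[OF T] by blast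
  have *: "T u \<in> hsegment (T z) (T w)" if "u \<in> hsegment z w" "hmotion T" "z \<in> hplane" "w \<in> hplane" for T u z w
    using that by (auto simp: hsegment_def hdist_hmotion hmotion_hplane)
  show ?thesis
  proof
    show "T ` hsegment z w \<subseteq> hsegment (T z) (T w)" using *[OF _ T zw] by blast
    show "hsegment (T z) (T w) \<subseteq> T ` hsegment z w"
    proof
      fix u assume u: "u \<in> hsegment (T z) (T w)"
      then have "T' u \<in> hsegment z w"
        using *[OF u T'(1)] T'(2) zw hmotion_hplane[OF T] by auto
      moreover have "T (T' u) = u" using u T'(3) by (auto simp: hsegment_def)
      ultimately show "u \<in> T ` hsegment z w" by (metis imageI)
    qed
  qed
qed

section \<open>Invariance of sides, interiors and simplicity under motions\<close>

lemma hvertex_in_set: "P \<noteq> [] \<Longrightarrow> hvertex P i \<in> set P"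
  by (simp add: hvertex_def)

lemma hvertex_map: "P \<noteq> [] \<Longrightarrow> hvertex (map T P) i = T (hvertex P i)"
  by (simp add: hvertex_def)

lemma hside_subset_hplane: "hside P i \<subseteq> hplane"
  by (auto simp: hside_def hsegment_def)

lemma hboundary_subset_hplane: "hboundary P \<subseteq> hplane"
  using hside_subset_hplane by (auto simp: hboundary_def)

lemma compact_hboundary:
  assumes "set P \<subseteq> hplane"
  shows "compact (hboundary P)"
  unfolding hboundary_def hside_def
proof (intro compact_UN compact_hsegment finite_lessThan)
  fix i assume "i \<in> {..<length P}"
  then have "P \<noteq> []" by auto
  then show "cmod (hvertex P i) < 1" "cmod (hvertex P (Suc i)) < 1"
    using assms hvertex_in_set by (force simp: hplane_def)+
qed

context
  fixes T :: "complex \<Rightarrow> complex" and P :: "complex list"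
  assumes T: "hmotion T" and P: "P \<noteq> []" "set P \<subseteq> hplane"
begin

lemma hvertex_hplane: "hvertex P i \<in> hplane"
  using hvertex_in_set P by blast

lemma hside_length_map: "hside_length (map T P) i = hside_length P i"
  by (simp add: hside_length_def hvertex_map P hdist_hmotion T hvertex_hplane)

lemma hside_map: "hside (map T P) i = T ` hside P i"
  by (simp add: hside_def hvertex_map P hsegment_hmotion T hvertex_hplane)

lemma hinterior_map: "hinterior (map T P) = T ` hinterior P"
proof -
  have "hboundary (map T P) = T ` hboundary P"
    by (simp add: hboundary_def hside_map image_UN)
  then show ?thesis
    unfolding hinterior_def
    by (simp add: inside_hmotion_image[OF T compact_hboundary[OF P(2)] hboundary_subset_hplane])
qed

lemma hpolygon_map:
  assumes "hpolygon n P"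
  shows "hpolygon n (map T P)"
proof -
  have "inj_on T (set P)" using inj_on_hmotion[OF T] P(2) inj_on_subset by blast
  moreover have "T ` hside P i \<inter> T ` hside P j = T ` (hside P i \<inter> hside P j)" for i j
    using inj_on_image_Int[OF inj_on_hmotion[OF T] hside_subset_hplane hside_subset_hplane] by metis
  moreover have "{T (hvertex P i), T (hvertex P i')} \<inter> {T (hvertex P j), T (hvertex P j')} =
      T ` ({hvertex P i, hvertex P i'} \<inter> {hvertex P j, hvertex P j'})" for i i' j j'
    using inj_on_image_Int[OF inj_on_hmotion[OF T], of "{hvertex P i, hvertex P i'}" "{hvertex P j, hvertex P j'}"]
      hvertex_hplane by simp
  ultimately show ?thesis
    using assms hmotion_hplane[OF T] P
    by (auto simp: hpolygon_def distinct_map hside_map hvertex_map simp del: Int_insert_left Int_insert_right)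
qed

end

section \<open>Invariance of interior angles: measuring a set of directions modulo a full
  turn\<close>

lemma emeasure_lborel_plus_vimage:
  fixes c :: real
  assumes "X \<in> sets borel"
  shows "emeasure lborel ((+) c -` X) = emeasure lborel X"
proof -
  have "emeasure lborel X = emeasure (distr lborel borel ((+) c)) X" by (simp add: lborel_distr_plus)
  also have "\<dots> = emeasure lborel ((+) c -` X)"
    using assms by (subst emeasure_distr) auto
  finally show ?thesis by simp
qed

text \<open>A shift modulo \<open>p\<close> cuts the set at \<open>c\<close>: the part above
  \<open>c\<close> moves down by \<open>c\<close>, the part below moves up by \<open>p - c\<close>.
  The two pieces are translates of disjoint sets, which gives measurability and measure
  together.\<close>

lemma periodic_translate_aux:
  fixes Q :: "real \<Rightarrow> bool"
  assumes per: "\<And>x. Q (x + p) = Q x" and c: "0 \<le> c" "c \<le> p"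
    and A: "{x \<in> {0..<p}. Q x} \<in> sets borel"
  shows "{x \<in> {0..<p}. Q (x + c)} \<in> sets borel"
    and "emeasure lborel {x \<in> {0..<p}. Q (x + c)} = emeasure lborel {x \<in> {0..<p}. Q x}"
proof -
  let ?A = "{x \<in> {0..<p}. Q x}" and ?B = "{x \<in> {0..<p}. Q (x + c)}"
  let ?B1 = "(+) c -` (?A \<inter> {c..})" and ?B2 = "(+) (c - p) -` (?A \<inter> {..<c})"
  have per': "Q (x + c - p) = Q (x + c)" for x using per[of "x + c - p"] by (simp add: algebra_simps)
  have B: "?B = ?B1 \<union> ?B2"
    using c by (auto simp: per' algebra_simps) 
  have AB: "?A \<inter> {c..} \<in> sets borel" "?A \<inter> {..<c} \<in> sets borel"
    using A by (auto intro!: sets.Int)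
  have "(+) d -` X \<in> sets borel" if "X \<in> sets borel" for X and d :: real
  proof -
    have "(+) d \<in> borel_measurable borel" by measurable
    from measurable_sets[OF this that] show ?thesis by simp
  qed
  then have B12: "?B1 \<in> sets borel" "?B2 \<in> sets borel" using AB by blast+
  then show "?B \<in> sets borel" unfolding B by (rule sets.Un)
  have "emeasure lborel ?B = emeasure lborel ?B1 + emeasure lborel ?B2"
    unfolding B using B12 by (intro plus_emeasure[symmetric]) auto
  also have "\<dots> = emeasure lborel (?A \<inter> {c..}) + emeasure lborel (?A \<inter> {..<c})"
    using AB by (simp only: emeasure_lborel_plus_vimage)
  also have "\<dots> = emeasure lborel (?A \<inter> {c..} \<union> ?A \<inter> {..<c})"
  proof (rule plus_emeasure)
    show "?A \<inter> {c..} \<inter> (?A \<inter> {..<c}) = {}" by fastforce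
  qed (use AB in \<open>simp_all only: sets_lborel\<close>)
  also have "?A \<inter> {c..} \<union> ?A \<inter> {..<c} = ?A" by auto
  finally show "emeasure lborel ?B = emeasure lborel ?A" .
qed

text \<open>The junk value \<open>measure M X = 0\<close> for non-measurable \<open>X\<close> does no harm: the two sets are both
  measurable or both non-measurable.\<close>

lemma measure_periodic_translate:
  fixes Q :: "real \<Rightarrow> bool"
  assumes per: "\<And>x. Q (x + p) = Q x" and c: "0 \<le> c" "c \<le> p"
  shows "measure lborel {x \<in> {0..<p}. Q (x + c)} = measure lborel {x \<in> {0..<p}. Q x}"
proof (cases "{x \<in> {0..<p}. Q x} \<in> sets borel")
  case True
  then show ?thesis
    using periodic_translate_aux(2)[of Q, OF per c True] by (simp only: measure_def)
next
  case False
  have per': "Q (x + p + c) = Q (x + c)" for x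
    using per[of "x + c"] by (simp add: algebra_simps)
  have "{x \<in> {0..<p}. Q (x + c)} \<notin> sets borel"
  proof
    assume "{x \<in> {0..<p}. Q (x + c)} \<in> sets borel"
    \<comment> \<open>A further shift by \<open>p - c\<close> completes a full period and recovers
      the original set.\<close>
    from periodic_translate_aux(1)[of "\<lambda>x. Q (x + c)" p "p - c", OF per' _ _ this] c
    have "{x \<in> {0..<p}. Q (x + p)} \<in> sets borel" by simp
    with False show False by (simp add: per)
  qed
  with False show ?thesis by (simp add: measure_notin_sets)
qed

text \<open>\<open>T\<close> takes the ray with direction \<open>\<theta>\<close> at the vertex to
  the ray with direction \<open>\<theta> + \<gamma>\<close> at its image, so the set of inward
  directions is shifted modulo \<open>2 * pi\<close> by a constant.\<close>

lemma hinterior_angle_map: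
  assumes T: "hmotion T" and P: "P \<noteq> []" "set P \<subseteq> hplane"
  shows "hinterior_angle (map T P) i = hinterior_angle P i"
proof -
  define v where "v = hvertex P i"
  have v: "cmod v < 1" using hvertex_in_set[OF P(1), of i] P(2) by (auto simp: v_def hplane_def)
  obtain \<gamma> where \<gamma>: "0 \<le> \<gamma>" "\<gamma> < 2 * pi"
    "\<And>z. cmod z < 1 \<Longrightarrow> T (mob v z) = mob (T v) (cis \<gamma> * z)"
    using hmotion_mob_comp[OF T v] by blast
  have hray: "hray v \<theta> t = mob v (of_real (tanh (t / 2)) * cis \<theta>)" for v \<theta> t
    by (simp add: hray_def mob_def Let_def)
  have tanh: "cmod (of_real (tanh (t / 2)) * cis \<theta>) < 1" for t \<theta>
    using tanh_real_bounds[of "t / 2"] by (simp add: norm_mult abs_less_iff)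
  have ray: "hray (T v) (\<theta> + \<gamma>) t = T (hray v \<theta> t)" for \<theta> t
    unfolding hray \<gamma>(3)[OF tanh] by (simp add: cis_mult[symmetric] mult_ac)
  have "hray v \<theta> t \<in> hplane" for \<theta> t
    unfolding hray hplane_def using norm_mob_less[OF v tanh] by simp
  then have mem: "T (hray v \<theta> t) \<in> T ` hinterior P \<longleftrightarrow> hray v \<theta> t \<in> hinterior P" for \<theta> t
    using inj_on_image_mem_iff[OF inj_on_hmotion[OF T]]
      inside_subset_hplane[OF hboundary_subset_hplane] by (simp add: hinterior_def)
  define Q where "Q \<theta> \<longleftrightarrow> eventually (\<lambda>t. hray (T v) \<theta> t \<in> T ` hinterior P) (at_right 0)" for \<theta>
  have "Q (\<theta> + 2 * pi) = Q \<theta>" for \<theta>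
    by (simp add: Q_def hray_def cis_mult[symmetric])
  from measure_periodic_translate[of Q, OF this, of \<gamma>] \<gamma>(1,2)
  have "measure lborel {\<theta> \<in> {0..<2 * pi}. Q (\<theta> + \<gamma>)} = measure lborel {\<theta> \<in> {0..<2 * pi}. Q \<theta>}" by simp
  moreover have "Q (\<theta> + \<gamma>) \<longleftrightarrow> eventually (\<lambda>t. hray v \<theta> t \<in> hinterior P) (at_right 0)" for \<theta>
    by (simp add: Q_def ray mem)
  ultimately show ?thesis
    by (simp add: hinterior_angle_def hvertex_map[OF P(1)] hinterior_map[OF T P] Q_def v_def)
qed

lemma hregular_map:
  assumes "hmotion T" "P \<noteq> []" "set P \<subseteq> hplane"
  shows "hregular (map T P) \<longleftrightarrow> hregular P"
  using assms by (simp add: hregular_def hside_length_map hinterior_angle_map)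

lemma hperimeter_map:
  assumes "hmotion T" "P \<noteq> []" "set P \<subseteq> hplane"
  shows "hperimeter (map T P) = hperimeter P"
  using assms by (simp add: hperimeter_def hside_length_map)

section \<open>Jensen's inequality\<close>

text \<open>Strict concavity in tangent form: as the argument grows towards \<open>pi / 2\<close>,
  the numerator \<open>S * cos x\<close> of the derivative falls and its denominator rises. The mean
  value theorem on either side of \<open>a\<close> then gives the strict inequality.\<close>

lemma arsinh_sin_below_tangent:
  fixes S a x :: real
  assumes S: "0 < S" and a: "0 < a" "a < pi / 2" and x: "0 < x" "x < pi / 2" and "x \<noteq> a"
  shows "arsinh (S * sin x) < arsinh (S * sin a) + S * cos a / sqrt ((S * sin a)\<^sup>2 + 1) * (x - a)"
proof -
  define g where "g = (\<lambda>x. arsinh (S * sin x))"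
  define g' where "g' = (\<lambda>x. S * cos x / sqrt ((S * sin x)\<^sup>2 + 1))"
  have D: "(g has_real_derivative g' y) (at y)" for y
  proof -
    have "((\<lambda>y. S * sin y) has_real_derivative S * cos y) (at y)"
      by (auto intro!: derivative_eq_intros)
    from DERIV_chain2[OF arsinh_real_has_field_derivative this] show ?thesis
      by (simp add: g_def g'_def)
  qed
  have dec: "g' z < g' y" if "0 < y" "y < z" "z < pi / 2" for y z
  proof -
    have "0 < cos z" "cos z < cos y" using that by (auto intro!: cos_gt_zero cos_monotone_0_pi)
    moreover have "0 < sin y" "sin y < sin z"
      using that by (auto intro!: sin_gt_zero sin_monotone_2pi)
    moreover from this have "(S * sin y)\<^sup>2 < (S * sin z)\<^sup>2"
      using S by (intro power_strict_mono) auto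
    ultimately show ?thesis
      unfolding g'_def using S by (intro frac_less) (auto simp: add_nonneg_pos)
  qed
  consider "a < x" | "x < a" using \<open>x \<noteq> a\<close> by linarith
  then have "g x - g a < g' a * (x - a)"
  proof cases
    case 1
    then obtain z where "a < z" "z < x" "g x - g a = (x - a) * g' z" using MVT2[OF 1 D] by auto
    then show ?thesis using dec[of a z] a x 1 by (simp add: mult.commute)
  next
    case 2
    then obtain z where z: "x < z" "z < a" "g a - g x = (a - x) * g' z" using MVT2[OF 2 D] by auto
    then have "(a - x) * g' a < (a - x) * g' z" using dec[of z a] a x 2 by (intro mult_strict_left_mono) auto
    then show ?thesis using z by (simp add: algebra_simps)
  qed
  then show ?thesis by (simp add: g_def g'_def)
qed

text \<open>Summing the tangent bound at \<open>pi / real n\<close>, the linear terms cancel because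
  the angles sum to \<open>pi\<close>. The tangent point lies below \<open>pi / 2\<close> since
  \<open>n\<close> is at least 3. A single angle different from it makes the sum strictly
  smaller.\<close>

lemma sum_arsinh_sin:
  fixes x :: "nat \<Rightarrow> real"
  assumes S: "0 < S" and n: "3 \<le> n" and x: "\<And>i. i < n \<Longrightarrow> 0 < x i \<and> x i < pi / 2"
    and sum: "(\<Sum>i<n. x i) = pi"
  shows "(\<Sum>i<n. arsinh (S * sin (x i))) \<le> real n * arsinh (S * sin (pi / real n))"
    and "(\<Sum>i<n. arsinh (S * sin (x i))) = real n * arsinh (S * sin (pi / real n)) \<longleftrightarrow>
      (\<forall>i<n. x i = pi / real n)"
proof -
  define a where "a = pi / real n"
  have a: "0 < a" "a < pi / 2" using n by (auto simp: a_def field_simps)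
  define c where "c = S * cos a / sqrt ((S * sin a)\<^sup>2 + 1)"
  define t where "t y = arsinh (S * sin a) + c * (y - a)" for y
  have sum_t: "(\<Sum>i<n. t (x i)) = real n * arsinh (S * sin a)"
    using n by (simp add: t_def sum.distrib sum_subtractf sum_distrib_left[symmetric] sum a_def)
  have lt: "arsinh (S * sin (x i)) < t (x i)" if "i < n" "x i \<noteq> a" for i
    using arsinh_sin_below_tangent[OF S a] x that by (simp add: t_def c_def)
  have le: "arsinh (S * sin (x i)) \<le> t (x i)" if "i < n" for i
    using lt[OF that] by (cases "x i = a") (auto simp: t_def)
  show "(\<Sum>i<n. arsinh (S * sin (x i))) \<le> real n * arsinh (S * sin (pi / real n))"
    unfolding a_def[symmetric] sum_t[symmetric] by (intro sum_mono le) simp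
  show "(\<Sum>i<n. arsinh (S * sin (x i))) = real n * arsinh (S * sin (pi / real n)) \<longleftrightarrow>
      (\<forall>i<n. x i = pi / real n)"
    unfolding a_def[symmetric]
  proof
    assume "(\<Sum>i<n. arsinh (S * sin (x i))) = real n * arsinh (S * sin a)"
    then have "\<not> (\<Sum>i<n. arsinh (S * sin (x i))) < (\<Sum>i<n. t (x i))" by (simp add: sum_t)
    then show "\<forall>i<n. x i = a"
      using sum_strict_mono_ex1[of "{..<n}" "\<lambda>i. arsinh (S * sin (x i))" "\<lambda>i. t (x i)"] le lt by auto
  qed simp
qed

section \<open>Polygons centered at the origin\<close>

text \<open>Twice the signed area of the triangle \<open>a\<close>, \<open>b\<close>,
  \<open>x\<close>, positive to the left of the line directed from \<open>a\<close> to
  \<open>b\<close>.\<close>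

definition chord_side :: "complex \<Rightarrow> complex \<Rightarrow> complex \<Rightarrow> real" where
  "chord_side a b x = Im ((x - a) * cnj (b - a))"

lemma chord_side_affine: "chord_side a b ((1 - t) *\<^sub>R p + t *\<^sub>R q) = (1 - t) * chord_side a b p + t * chord_side a b q"
  by (simp add: chord_side_def algebra_simps)

lemma chord_side_endpoints [simp]: "chord_side a b a = 0" "chord_side a b b = 0"
  by (simp_all add: chord_side_def algebra_simps)

text \<open>The formula for the norm is the power of the point \<open>x\<close>: the sign of
  \<open>t * (1 - t)\<close> tells whether a point of the line is inside, on or outside the
  circle.\<close>

lemma chord_side_eq_0_on_circle:
  assumes r: "cmod a = r" "cmod b = r" and "a \<noteq> b" and "chord_side a b x = 0"
  obtains t where "x = (1 - t) *\<^sub>R a + t *\<^sub>R b" "(cmod x)\<^sup>2 = r\<^sup>2 - t * (1 - t) * (cmod (b - a))\<^sup>2"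
proof -
  define t where "t = Re ((x - a) / (b - a))"
  have "Im ((x - a) / (b - a)) = 0"
    using assms(4) unfolding chord_side_def by (subst complex_div_cnj) simp
  then have "(x - a) / (b - a) = of_real t" by (simp add: complex_eq_iff t_def)
  then have "x - a = of_real t * (b - a)" using \<open>a \<noteq> b\<close> by (simp add: field_simps)
  then have x: "x = (1 - t) *\<^sub>R a + t *\<^sub>R b" by (simp add: scaleR_conv_of_real algebra_simps)
  have "(norm x)\<^sup>2 = (1 - t) * (norm a)\<^sup>2 + t * (norm b)\<^sup>2 - t * (1 - t) * (norm (b - a))\<^sup>2"
    unfolding x power2_norm_eq_inner
    by (simp add: inner_simps inner_commute[of a b] algebra_simps power2_eq_square)
  also have "\<dots> = r\<^sup>2 - t * (1 - t) * (norm (b - a))\<^sup>2"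
    unfolding r by (simp add: algebra_simps)
  finally show thesis using x that by blast
qed

lemma chord_side_eq_0_in_disc:
  assumes "cmod a = r" "cmod b = r" "a \<noteq> b" "chord_side a b x = 0" "cmod x \<le> r"
  shows "x \<in> closed_segment a b"
proof -
  obtain t where t: "x = (1 - t) *\<^sub>R a + t *\<^sub>R b" "(cmod x)\<^sup>2 = r\<^sup>2 - t * (1 - t) * (cmod (b - a))\<^sup>2"
    using chord_side_eq_0_on_circle[OF assms(1-4)] by blast
  have "(cmod x)\<^sup>2 \<le> r\<^sup>2" using assms(5) by (simp add: power_mono)
  then have "0 \<le> t * (1 - t) * (cmod (b - a))\<^sup>2" using t(2) by simp
  then have "0 \<le> t * (1 - t)" using assms(3) by (simp add: zero_le_mult_iff)
  then have "0 \<le> t" "t \<le> 1" by (auto simp: zero_le_mult_iff)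
  then show ?thesis using t(1) by (auto simp: in_segment)
qed

lemma chord_side_neq_0_on_circle:
  assumes "cmod a = r" "cmod b = r" "a \<noteq> b" "cmod x = r" "x \<noteq> a" "x \<noteq> b"
  shows "chord_side a b x \<noteq> 0"
proof
  assume "chord_side a b x = 0"
  then obtain t where t: "x = (1 - t) *\<^sub>R a + t *\<^sub>R b" "(cmod x)\<^sup>2 = r\<^sup>2 - t * (1 - t) * (cmod (b - a))\<^sup>2"
    using chord_side_eq_0_on_circle[OF assms(1-3)] by blast
  then have "t = 0 \<or> t = 1" using assms by auto
  then show False using t(1) assms by auto
qed

lemma chord_side_zero_between:
  assumes "chord_side a b p * chord_side a b q < 0"
  obtains x where "x \<in> closed_segment p q" "chord_side a b x = 0"
proof -
  define t where "t = chord_side a b p / (chord_side a b p - chord_side a b q)"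
  have "chord_side a b p \<noteq> chord_side a b q" using assms by (metis less_irrefl not_square_less_zero)
  then have *: "(1 - t) * chord_side a b p + t * chord_side a b q = 0"
    by (simp add: t_def field_simps)
  have "0 \<le> t \<and> t \<le> 1"
    using assms by (auto simp: t_def mult_less_0_iff divide_simps)
  then show thesis
    using that[of "(1 - t) *\<^sub>R p + t *\<^sub>R q"] * by (auto simp: in_segment chord_side_affine)
qed

text \<open>The common rotation by \<open>a\<close> drops out because \<open>a * cnj a\<close> is
  real. The product form is chosen because signs can be read off from it factor by factor.\<close>

lemma chord_side_cis:
  "chord_side a (a * cis d) (a * cis f) = (cmod a)\<^sup>2 * (4 * sin (d / 2) * sin (f / 2) * sin ((f - d) / 2))"
  and chord_side_cis_0: "chord_side a (a * cis d) 0 = (cmod a)\<^sup>2 * sin d"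
proof -
  have aa: "a * cnj a = of_real ((cmod a)\<^sup>2)" by (simp only: complex_norm_square)
  have "chord_side a (a * cis d) (a * cis f) = Im (a * cnj a * ((cis f - 1) * (cis (- d) - 1)))"
    unfolding chord_side_def by (simp add: algebra_simps cis_cnj)
  also have "\<dots> = (cmod a)\<^sup>2 * (sin (f - d) - sin f + sin d)"
    unfolding aa by (simp add: algebra_simps sin_diff)
  also have "sin (f - d) - sin f + sin d = 4 * sin (d / 2) * sin (f / 2) * sin ((f - d) / 2)"
  proof -
    \<comment> \<open>In half angles the double angle formulas make the identity polynomial modulo
      the two Pythagorean relations.\<close>
    define u v where "u = d / 2" and "v = f / 2"
    have s: "(sin u)\<^sup>2 = 1 - (cos u)\<^sup>2" "(sin v)\<^sup>2 = 1 - (cos v)\<^sup>2" by (simp_all add: sin_squared_eq)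
    have e: "d = 2 * u" "f = 2 * v" "(f - d) / 2 = v - u" by (simp_all add: u_def v_def)
    have "sin (2 * v - 2 * u) - sin (2 * v) + sin (2 * u) = 4 * sin u * sin v * sin (v - u)"
      unfolding sin_diff sin_double cos_double using s by algebra
    then show ?thesis unfolding e by (simp add: u_def v_def diff_divide_distrib)
  qed
  finally show "chord_side a (a * cis d) (a * cis f) = (cmod a)\<^sup>2 * (4 * sin (d / 2) * sin (f / 2) * sin ((f - d) / 2))" .
  have "chord_side a (a * cis d) 0 = Im (a * cnj a * (1 - cis (- d)))"
    unfolding chord_side_def by (simp add: algebra_simps cis_cnj)
  also have "\<dots> = (cmod a)\<^sup>2 * sin d"
    unfolding aa by simp
  finally show "chord_side a (a * cis d) 0 = (cmod a)\<^sup>2 * sin d" .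
qed

lemma hvertex_mod: "hvertex P (i mod length P) = hvertex P i"
  by (simp add: hvertex_def)

lemma hvertex_Suc_mod: "hvertex P (Suc (i mod length P)) = hvertex P (Suc i)"
  by (simp add: hvertex_def mod_Suc_eq)

lemma hside_mod: "hside P (i mod length P) = hside P i"
  by (simp add: hside_def hvertex_mod hvertex_Suc_mod)

text \<open>With all natural indices allowed, the closing side and cyclic shifts need no special
  case.\<close>

lemma hboundary_eq_UNIV: "P \<noteq> [] \<Longrightarrow> hboundary P = (\<Union>i. hside P i)"
  unfolding hboundary_def using hside_mod by (force intro!: bexI[of _ "i mod length P" for i])

text \<open>The perpendicular from the centre halves the isosceles triangle; in the right-angled
  half, half the side has \<open>sinh\<close> equal to \<open>sinh\<close> of the radius times the
  sine of half the angle. The absolute value allows negative \<open>d\<close>.\<close>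

lemma hdist_on_circle:
  assumes "cmod z = \<rho>" "cmod w = \<rho>" "\<rho> < 1" "w = z * cis d"
  shows "hdist z w = 2 * arsinh (sinh (hdist 0 z) * \<bar>sin (d / 2)\<bar>)"
proof -
  have \<rho>: "0 < 1 - \<rho>\<^sup>2" "0 \<le> \<rho>" using assms by (auto simp: abs_square_less_1)
  have S: "sinh (hdist 0 z) = 2 * \<rho> / (1 - \<rho>\<^sup>2)" using cosh_sinh_hdist_0(2)[of z] assms by simp
  have "(cmod (1 - cis d))\<^sup>2 = 4 * (sin (d / 2))\<^sup>2"
  proof -
    have "(cmod (1 - cis d))\<^sup>2 = (1 - cos d)\<^sup>2 + (sin d)\<^sup>2" by (simp add: cmod_power2)
    also have "\<dots> = 2 - 2 * cos d" by (simp add: sin_squared_eq power2_diff)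
    also have "\<dots> = 4 * (sin (d / 2))\<^sup>2" using cos_double_sin[of "d / 2"] by simp
    finally show ?thesis .
  qed
  moreover have "z - w = z * (1 - cis d)" using assms by (simp add: algebra_simps)
  ultimately have zw: "(cmod (z - w))\<^sup>2 = \<rho>\<^sup>2 * (4 * (sin (d / 2))\<^sup>2)"
    using assms(1) by (simp only: norm_mult power_mult_distrib)
  have "cosh (hdist z w) = 1 + 2 * (sinh (hdist 0 z) * \<bar>sin (d / 2)\<bar>)\<^sup>2"
    using cosh_hdist(1)[of z w] assms(1-3) \<rho> unfolding zw S
    by (simp add: power_mult_distrib power_divide power2_eq_square)
  moreover have "cosh (hdist z w) = 1 + 2 * (sinh (hdist z w / 2))\<^sup>2"
    using cosh_double[of "hdist z w / 2"] by (simp add: cosh_square_eq)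
  ultimately have "(sinh (hdist z w / 2))\<^sup>2 = (sinh (hdist 0 z) * \<bar>sin (d / 2)\<bar>)\<^sup>2" by simp
  moreover have "0 \<le> sinh (hdist z w / 2)" "0 \<le> sinh (hdist 0 z) * \<bar>sin (d / 2)\<bar>"
    using cosh_hdist(2)[of z w] assms(1-3) \<rho> by (simp_all add: S)
  ultimately have "sinh (hdist z w / 2) = sinh (hdist 0 z) * \<bar>sin (d / 2)\<bar>"
    by (rule power2_eq_imp_eq)
  then have "arsinh (sinh (hdist 0 z) * \<bar>sin (d / 2)\<bar>) = hdist z w / 2"
    by (metis arsinh_sinh_real)
  then show ?thesis by simp
qed

section \<open>Orientation and sum of the central angles\<close>

context
  fixes n :: nat and P :: "complex list" and \<rho> :: real
  assumes polygon: "hpolygon n P" and circle: "\<And>z. z \<in> set P \<Longrightarrow> cmod z = \<rho>"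
    and \<rho>: "0 < \<rho>" "\<rho> < 1" and center: "0 \<in> hinterior P"
begin

private abbreviation v where "v i \<equiv> hvertex P i"
private abbreviation K where "K i \<equiv> klein (hvertex P i)"
private abbreviation X where "X i \<equiv> chord_side (K i) (K (Suc i))"

private lemma n_facts: "3 \<le> n" "length P = n" "P \<noteq> []" "distinct P"
  using polygon by (auto simp: hpolygon_def)

private lemma norm_v: "cmod (v i) = \<rho>"
  using circle hvertex_in_set[OF n_facts(3)] by blast

private lemma v_period: "v (i + n) = v i"
  by (simp add: hvertex_def n_facts(2))

private lemma K_eq: "K i = (2 / (1 + \<rho>\<^sup>2)) *\<^sub>R v i"
  by (simp add: klein_def norm_v)

private lemma norm_K: "cmod (K i) = 2 * \<rho> / (1 + \<rho>\<^sup>2)" "cmod (K i) < 1"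
  using norm_klein[of "v i"] norm_klein_less[of "v i"] \<rho> by (simp_all add: norm_v)

private lemma v_neq: "0 < m \<Longrightarrow> m < n \<Longrightarrow> v (i + m) \<noteq> v i"
proof
  assume m: "0 < m" "m < n" "v (i + m) = v i"
  then have "(i + m) mod n = i mod n"
    using n_facts nth_eq_iff_index_eq[of P "(i + m) mod n" "i mod n"] by (simp add: hvertex_def)
  then have "n dvd m" using mod_eq_dvd_iff_nat[of i "i + m" n] by simp
  then show False using m dvd_imp_le by fastforce
qed

private lemma K_neq: "0 < m \<Longrightarrow> m < n \<Longrightarrow> K (i + m) \<noteq> K i"
proof -
  assume "0 < m" "m < n"
  moreover have "0 < 1 + \<rho>\<^sup>2" by (simp add: add_pos_nonneg)
  ultimately show ?thesis using v_neq[of m i] by (simp add: K_eq)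
qed

private lemma in_hside_iff: "u \<in> hside P i \<longleftrightarrow> cmod u < 1 \<and> klein u \<in> closed_segment (K i) (K (Suc i))"
  using hsegment_iff_klein[of "v i" "v (Suc i)" u] \<rho>
  by (auto simp: hside_def norm_v) (auto simp: hsegment_def hplane_def)

text \<open>A side with endpoints strictly on both sides of the line of chord \<open>i\<close> meets
  that line inside the circle, hence meets the chord itself. Simplicity makes the two sides share a
  vertex, and there \<open>X i\<close> vanishes, contrary to the strict signs.\<close>

private lemma no_crossing: "\<not> X i (K j) * X i (K (Suc j)) < 0"
proof
  assume neg: "X i (K j) * X i (K (Suc j)) < 0"
  then obtain x where x: "x \<in> closed_segment (K j) (K (Suc j))" "X i x = 0"
    by (rule chord_side_zero_between)
  have "cmod x \<le> 2 * \<rho> / (1 + \<rho>\<^sup>2)"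
    using convex_cball[of 0 "2 * \<rho> / (1 + \<rho>\<^sup>2)"] x(1) norm_K(1)
      closed_segment_subset[of "K j" "cball 0 (2 * \<rho> / (1 + \<rho>\<^sup>2))" "K (Suc j)"] by auto
  then have xi: "x \<in> closed_segment (K i) (K (Suc i))"
    using x(2) norm_K(1) K_neq[of 1 i] n_facts by (intro chord_side_eq_0_in_disc) auto
  have x1: "cmod x < 1" using \<open>cmod x \<le> _\<close> norm_K[of 0] by simp
  then have "klein_inv x \<in> hside P i \<inter> hside P j"
    using x(1) xi klein_klein_inv[OF x1] by (simp add: in_hside_iff)
  then have "hside P (i mod n) \<inter> hside P (j mod n) \<noteq> {}"
    using hside_mod[of P] n_facts(2) by auto
  moreover have "i mod n \<noteq> j mod n"
  proof
    assume "i mod n = j mod n"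
    then have "K i = K j" using hvertex_mod[of P] n_facts(2) by metis
    then show False using neg by simp
  qed
  moreover have "hside P a \<inter> hside P b = {v a, v (Suc a)} \<inter> {v b, v (Suc b)}"
    if "a < n" "b < n" "a \<noteq> b" for a b
    using polygon that unfolding hpolygon_def by blast
  moreover have "i mod n < n" "j mod n < n" using n_facts(1) by auto
  ultimately have "{v (i mod n), v (Suc (i mod n))} \<inter> {v (j mod n), v (Suc (j mod n))} \<noteq> {}"
    by metis
  then have "{v i, v (Suc i)} \<inter> {v j, v (Suc j)} \<noteq> {}"
    using hvertex_mod[of P] hvertex_Suc_mod[of P] n_facts(2) by simp
  then show False using neg by auto
qed

text \<open>Walking along the polygon from \<open>i + 2\<close>, no vertex lies on the line of chord
  \<open>i\<close>, since a line meets the circle in two points only, and no side crosses it. So the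
  sign never changes.\<close>

private lemma same_side:
  assumes "2 \<le> m" "m < n"
  shows "0 < X i (K (i + 2)) * X i (K (i + m))"
  using assms
proof (induction m rule: dec_induct)
  case base
  have "X i (K (i + 2)) \<noteq> 0"
    using norm_K(1) K_neq[of 1 i] K_neq[of 2 i] K_neq[of 1 "Suc i"] n_facts
    by (intro chord_side_neq_0_on_circle) auto
  then show ?case by (auto simp: zero_less_mult_iff linorder_neq_iff)
next
  case (step m)
  have "X i (K (Suc (i + m))) \<noteq> 0"
    using norm_K(1) K_neq[of 1 i] K_neq[of "Suc m" i] K_neq[of m "Suc i"] n_facts step
    by (intro chord_side_neq_0_on_circle) auto
  moreover have "0 < X i (K (i + 2)) * X i (K (i + m))" using step by simp
  ultimately show ?case
    using no_crossing[of i "i + m"] by (auto simp: zero_less_mult_iff mult_less_0_iff)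
qed

text \<open>If the centre were on the other side of the chord, the ray from it orthogonal to the chord
  and pointing away would avoid the boundary.\<close>

private lemma center_same_side: "0 < X i 0 * X i (K (i + 2))"
proof (rule ccontr)
  assume neg: "\<not> 0 < X i 0 * X i (K (i + 2))"
  \<comment> \<open>Multiplying by \<open>s\<close> makes the side of the vertices the nonnegative
    one, whatever the orientation.\<close>
  define s where "s = X i (K (i + 2))"
  have "0 < s * s" using same_side[of 2 i] n_facts by (simp add: s_def)
  then have s0: "s \<noteq> 0" by auto
  have "X i 0 \<noteq> 0"
  proof
    assume "X i 0 = 0"
    then have "0 \<in> closed_segment (K i) (K (Suc i))"
      using norm_K(1)[of i] norm_K(1)[of "Suc i"] K_neq[of 1 i] n_facts \<rho>(1)
      by (intro chord_side_eq_0_in_disc[where r = "2 * \<rho> / (1 + \<rho>\<^sup>2)"]) (auto simp: add_nonneg_nonneg)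
    then have "0 \<in> hboundary P"
      using hboundary_eq_UNIV[OF n_facts(3)] by (auto simp: in_hside_iff klein_def)
    then show False using center by (auto simp: hinterior_def inside_def)
  qed
  then have neg: "s * X i 0 < 0"
    using neg s0 by (simp add: s_def mult.commute linorder_not_less order_le_less)
  have K_side: "0 \<le> s * X i (K j)" for j
  proof -
    \<comment> \<open>The cyclic offset from \<open>i\<close> to \<open>j\<close>, with the
      subtraction arranged to be safe in the naturals.\<close>
    define m where "m = (j + (n - i mod n)) mod n"
    have "m < n" using n_facts by (simp add: m_def)
    have "(i + m) mod n = (i mod n + (j + (n - i mod n))) mod n"
      by (simp add: m_def mod_simps)
    also have "i mod n + (j + (n - i mod n)) = j + n"
      using mod_less_divisor[of n i] n_facts(1) by linarith
    finally have K: "K j = K (i + m)"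
      using hvertex_mod[of P] n_facts(2) by (metis mod_add_self2)
    consider "m = 0" | "m = 1" | "2 \<le> m" by linarith
    then show ?thesis
      unfolding K by cases (use same_side[of m i] \<open>m < n\<close> in \<open>auto simp: s_def\<close>)
  qed
  have side: "0 \<le> s * X i (klein u)" if "u \<in> hboundary P" for u
  proof -
    obtain j where "klein u \<in> closed_segment (K j) (K (Suc j))"
      using \<open>u \<in> hboundary P\<close> hboundary_eq_UNIV[OF n_facts(3)] by (auto simp: in_hside_iff)
    then obtain t where t: "0 \<le> t" "t \<le> 1" "klein u = (1 - t) *\<^sub>R K j + t *\<^sub>R K (Suc j)"
      by (auto simp: in_segment)
    have "s * X i (klein u) = (1 - t) * (s * X i (K j)) + t * (s * X i (K (Suc j)))"
      unfolding t(3) chord_side_affine by (simp add: algebra_simps)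
    also have "0 \<le> \<dots>"
      using t(1,2) mult_nonneg_nonneg[OF _ K_side[of j], of "1 - t"]
        mult_nonneg_nonneg[OF _ K_side[of "Suc j"], of t] by linarith
    finally show ?thesis .
  qed
  \<comment> \<open>The chord turned by a right angle; the factor \<open>- s\<close> directs it away
    from the vertices.\<close>
  define d where "d = of_real (- s) * \<i> * (K (Suc i) - K i)"
  have d0: "d \<noteq> 0" using s0 K_neq[of 1 i] n_facts by (simp add: d_def)
  have ray: "s * X i (t *\<^sub>R d) < 0" if "0 \<le> t" for t
  proof -
    have "Im (d * cnj (K (Suc i) - K i)) = - s * (cmod (K (Suc i) - K i))\<^sup>2"
      unfolding d_def mult.assoc complex_norm_square[symmetric] by simp
    then have "X i (t *\<^sub>R d) = X i 0 - t * s * (cmod (K (Suc i) - K i))\<^sup>2"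
      by (simp add: chord_side_def left_diff_distrib)
    then have "s * X i (t *\<^sub>R d) = s * X i 0 - t * (s * s) * (cmod (K (Suc i) - K i))\<^sup>2"
      by (simp only: right_diff_distrib) simp
    moreover have "0 \<le> t * (s * s) * (cmod (K (Suc i) - K i))\<^sup>2" using that by simp
    ultimately show ?thesis using neg by linarith
  qed
  define R where "R = (\<lambda>t. t *\<^sub>R d) ` {0..}"
  have "R \<inter> hboundary P = {}"
  proof safe
    fix u assume "u \<in> R" "u \<in> hboundary P"
    then obtain t where "0 \<le> t" "u = t *\<^sub>R d" by (auto simp: R_def)
    \<comment> \<open>\<open>klein\<close> rescales radially by a nonnegative factor, so it maps the
      ray from the origin into itself and the sign bound applies to \<open>klein u\<close>
      too.\<close>
    then have "klein u = (2 / (1 + (cmod u)\<^sup>2) * t) *\<^sub>R d" "0 \<le> 2 / (1 + (cmod u)\<^sup>2) * t"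
      by (simp_all add: klein_def add_nonneg_nonneg)
    with ray side[OF \<open>u \<in> hboundary P\<close>] show "u \<in> {}" by (metis linorder_not_less)
  qed
  moreover have "connected R" unfolding R_def
    by (intro connected_continuous_image continuous_intros convex_connected) auto
  moreover have "0 \<in> R" unfolding R_def by (rule image_eqI[of _ _ 0]) auto
  ultimately have "R \<subseteq> connected_component_set (- hboundary P) 0"
    by (intro connected_component_maximal) auto
  moreover have "bounded (connected_component_set (- hboundary P) 0)"
    using center by (simp add: hinterior_def inside_def)
  ultimately have "bounded R" by (rule bounded_subset[rotated])
  then obtain B where B: "\<And>x. x \<in> R \<Longrightarrow> norm x \<le> B" by (auto simp: bounded_iff)
  have "0 \<le> B" using B[OF \<open>0 \<in> R\<close>] by simp
  then have "((B + 1) / cmod d) *\<^sub>R d \<in> R" unfolding R_def using d0 by (intro imageI) simp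
  from B[OF this] \<open>0 \<le> B\<close> d0 show False by simp
qed

text \<open>The signed central angle of side \<open>i\<close>. The principal value keeps its half
  within \<open>pi / 2\<close> of zero, where the cosine is nonnegative.\<close>

private definition \<delta> where "\<delta> i = Arg (v (Suc i) / v i)"

private lemma \<delta>_bounds: "- pi < \<delta> i" "\<delta> i \<le> pi"
  by (simp_all add: \<delta>_def mpi_less_Arg Arg_le_pi)

private lemma v_Suc: "v (Suc i) = v i * cis (\<delta> i)"
proof -
  have nz: "v j \<noteq> 0" for j using norm_v[of j] \<rho> by auto
  have "v (Suc i) / v i = cis (\<delta> i)"
    using norm_v[of i] norm_v[of "Suc i"] \<rho> cis_Arg[of "v (Suc i) / v i"] nz[of i] nz[of "Suc i"]
    by (simp add: \<delta>_def sgn_div_norm norm_divide)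
  then show ?thesis using nz[of i] by (simp add: field_simps)
qed

text \<open>The centre and vertex \<open>i + m\<close> lie on one side of chord \<open>i\<close>. In
  the product of the two chord values, the factors that depend on \<open>\<delta> i\<close> alone
  combine to something nonnegative, so the rest is positive. Any angle \<open>\<phi>\<close> leading
  to the vertex may be used, measured forwards or backwards.\<close>

private lemma sin_product_pos:
  assumes m: "2 \<le> m" "m < n" and \<phi>: "v (i + m) = v i * cis \<phi>"
  shows "0 < sin (\<phi> / 2) * sin ((\<phi> - \<delta> i) / 2)" and "\<delta> i \<noteq> 0" and "\<delta> i < pi"
proof -
  have K: "K (Suc i) = K i * cis (\<delta> i)" "K (i + m) = K i * cis \<phi>"
    unfolding K_eq by (simp_all add: v_Suc \<phi>)
  have "0 < X i 0 * X i (K (i + m))"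
    using center_same_side[of i] same_side[OF m, of i]
    by (auto simp: zero_less_mult_iff)
  then have *: "0 < sin (\<delta> i) * (4 * sin (\<delta> i / 2) * sin (\<phi> / 2) * sin ((\<phi> - \<delta> i) / 2))"
    unfolding K chord_side_cis chord_side_cis_0
  proof -
    assume *: "0 < (cmod (K i))\<^sup>2 * sin (\<delta> i) *
        ((cmod (K i))\<^sup>2 * (4 * sin (\<delta> i / 2) * sin (\<phi> / 2) * sin ((\<phi> - \<delta> i) / 2)))"
    have "0 < a * b" if "0 < c * a * (c * b)" for a b c :: real
    proof -
      have "0 < (c * c) * (a * b)" using that by (simp add: mult_ac)
      then show ?thesis by (metis linorder_not_less zero_le_square zero_less_mult_iff)
    qed
    from this[OF *] show ?thesis .
  qed
  also have "\<dots> = (8 * (sin (\<delta> i / 2))\<^sup>2 * cos (\<delta> i / 2)) * (sin (\<phi> / 2) * sin ((\<phi> - \<delta> i) / 2))"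
    using sin_double[of "\<delta> i / 2"] by (simp add: power2_eq_square)
  finally have "0 < (8 * (sin (\<delta> i / 2))\<^sup>2 * cos (\<delta> i / 2)) * (sin (\<phi> / 2) * sin ((\<phi> - \<delta> i) / 2))" .
  moreover have "0 \<le> 8 * (sin (\<delta> i / 2))\<^sup>2 * cos (\<delta> i / 2)"
    using \<delta>_bounds[of i] by (intro mult_nonneg_nonneg cos_ge_zero) auto
  ultimately show "0 < sin (\<phi> / 2) * sin ((\<phi> - \<delta> i) / 2)"
    by (metis linorder_not_less zero_less_mult_iff)
  have "sin (\<delta> i) \<noteq> 0" using * by auto
  then show "\<delta> i \<noteq> 0" "\<delta> i < pi" using \<delta>_bounds[of i] by (auto simp: order_le_less)
qed

text \<open>Chord \<open>i\<close> is tested against vertex \<open>i + 2\<close>, and chord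
  \<open>i + 1\<close> against vertex \<open>i\<close>. Both tests contain the sine of half of
  \<open>\<delta> i + \<delta> (Suc i)\<close>, and eliminating its sign leaves the two half angles
  with equal signs.\<close>

private lemma \<delta>_consecutive: "0 < \<delta> i * \<delta> (Suc i)"
proof -
  have "v (i + 2) = v i * cis (\<delta> i + \<delta> (Suc i))"
    by (simp add: v_Suc cis_mult[symmetric] mult.assoc)
  from sin_product_pos[OF _ _ this] n_facts
  have 1: "0 < sin ((\<delta> i + \<delta> (Suc i)) / 2) * sin (\<delta> (Suc i) / 2)" "\<delta> i \<noteq> 0" "\<delta> i < pi" by auto
  \<comment> \<open>Vertex \<open>i\<close> is reached as vertex \<open>i + n\<close>, with the
    angle measured backwards.\<close>
  have "v (Suc i + (n - 1)) = v (Suc i) * cis (- \<delta> i)"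
    using v_period[of i] n_facts by (simp add: v_Suc mult.assoc cis_mult)
  from sin_product_pos[OF _ _ this] n_facts
  have 2: "0 < sin (- \<delta> i / 2) * sin ((- \<delta> i - \<delta> (Suc i)) / 2)" "\<delta> (Suc i) \<noteq> 0" "\<delta> (Suc i) < pi" by auto
  have e: "(- x - y) / 2 = - ((x + y) / 2)" for x y :: real by (simp add: field_simps)
  have "0 < sin (\<delta> i / 2) * sin ((\<delta> i + \<delta> (Suc i)) / 2)"
    using 2(1) unfolding e minus_divide_left[symmetric] sin_minus by simp
  with 1 have "0 < sin (\<delta> i / 2) * sin (\<delta> (Suc i) / 2)"
    by (auto simp: zero_less_mult_iff)
  moreover have sgn: "0 < sin (x / 2) \<longleftrightarrow> 0 < x" if "- pi < x" "x < pi" for x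
  proof -
    have "0 < sin (x / 2)" if "0 < x" using that \<open>x < pi\<close> by (intro sin_gt_zero) auto
    moreover have "0 < sin (- x / 2)" if "x < 0" using that \<open>- pi < x\<close> by (intro sin_gt_zero) auto
    ultimately show ?thesis by (cases "x = 0") (auto simp: linorder_neq_iff)
  qed
  ultimately show ?thesis
    using sgn[OF \<delta>_bounds(1) 1(3)] sgn[OF \<delta>_bounds(1) 2(3)] 1(2) 2(2)
    by (smt (verit) zero_less_mult_iff)
qed

private lemma central_angles:
  obtains s \<theta> where "s = 1 \<or> s = -1" "\<And>i. 0 < \<theta> i" "\<And>i. \<theta> i < pi"
    "\<And>i. v (Suc i) = v i * cis (s * \<theta> i)" "(\<Sum>i<n. \<theta> i) = 2 * pi"
proof -
  define s where "s = sgn (\<delta> 0)"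
  define \<theta> where "\<theta> i = \<bar>\<delta> i\<bar>" for i
  have nz: "\<delta> i \<noteq> 0" for i using \<delta>_consecutive[of i] by auto
  have s: "s = 1 \<or> s = -1" using nz by (auto simp: s_def sgn_if)
  have sgn: "sgn (\<delta> i) = s" for i
  proof (induction i)
    case (Suc i)
    then show ?case using \<delta>_consecutive[of i] by (auto simp: sgn_if zero_less_mult_iff split: if_splits)
  qed (simp add: s_def)
  have \<delta>: "\<delta> i = s * \<theta> i" for i using sgn[of i] by (simp add: \<theta>_def sgn_mult_abs flip: sgn[of i])
  have pos: "0 < \<theta> i" for i using nz by (simp add: \<theta>_def)
  have v2: "v (i + 2) = v i * cis (\<delta> i + \<delta> (Suc i))" for i
    by (simp add: v_Suc cis_mult[symmetric] mult.assoc)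
  have ltpi: "\<theta> i < pi" for i
    using sin_product_pos(3)[OF _ _ v2, of i] \<delta>_bounds[of i] n_facts by (auto simp: \<theta>_def)
  define \<Phi> where "\<Phi> k = (\<Sum>i<k. \<theta> i)" for k
  have v: "v k = v 0 * cis (s * \<Phi> k)" for k
  proof (induction k)
    case (Suc k)
    have "v (Suc k) = v k * cis (s * \<theta> k)" by (simp add: v_Suc \<delta>)
    then show ?case
      by (simp add: Suc \<Phi>_def cis_mult distrib_left mult.assoc)
  qed (simp add: \<Phi>_def)
  have bounds: "0 < \<Phi> k \<and> \<Phi> k < 2 * pi" if "1 \<le> k" "k < n" for k
    using that
  proof (induction k rule: dec_induct)
    case base
    then show ?case using pos[of 0] ltpi[of 0] by (simp add: \<Phi>_def)
  next
    case (step k)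
    \<comment> \<open>Chord \<open>k\<close> is tested against vertex \<open>0\<close>, reached as
      vertex \<open>n\<close>; this ties the signs for \<open>\<Phi> k\<close> and
      \<open>\<Phi> (Suc k)\<close> together.\<close>
    have "v (k + (n - k)) = v k * cis (- (s * \<Phi> k))"
      using step v_period[of 0] by (simp add: v[of k] mult.assoc cis_mult)
    moreover have "2 \<le> n - k" "n - k < n" using step by auto
    ultimately have "0 < sin (- (s * \<Phi> k) / 2) * sin ((- (s * \<Phi> k) - \<delta> k) / 2)"
      using sin_product_pos(1) by blast
    also have "(- (s * \<Phi> k) - \<delta> k) / 2 = - (s * \<Phi> (Suc k)) / 2"
      by (simp add: \<delta> \<Phi>_def distrib_left)
    also have "sin (- (s * \<Phi> k) / 2) * sin (- (s * \<Phi> (Suc k)) / 2) = sin (\<Phi> k / 2) * sin (\<Phi> (Suc k) / 2)"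
      using s by auto
    finally have "0 < sin (\<Phi> k / 2) * sin (\<Phi> (Suc k) / 2)" .
    moreover have IH: "0 < \<Phi> k" "\<Phi> k < 2 * pi" using step by auto
    then have "0 < sin (\<Phi> k / 2)" by (intro sin_gt_zero) auto
    ultimately have "0 < sin (\<Phi> (Suc k) / 2)" by (simp add: zero_less_mult_iff)
    moreover have Suc: "\<Phi> (Suc k) = \<Phi> k + \<theta> k" by (simp add: \<Phi>_def)
    \<comment> \<open>A step below \<open>pi\<close> from below \<open>2 * pi\<close> stays below
      \<open>3 * pi\<close>, so overshooting \<open>2 * pi\<close> would make this sine
      nonpositive.\<close>
    have "sin (\<Phi> (Suc k) / 2) \<le> 0" if "2 * pi \<le> \<Phi> (Suc k)"
      using that IH ltpi[of k] by (intro sin_le_zero) (auto simp: Suc)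
    ultimately show ?case using IH pos[of k] Suc by force
  qed
  have "\<Phi> n = 2 * pi"
  proof -
    have "\<Phi> n = \<Phi> (n - 1) + \<theta> (n - 1)" using n_facts by (cases n) (auto simp: \<Phi>_def)
    \<comment> \<open>The total is a multiple of \<open>2 * pi\<close>, and this range contains only
      one.\<close>
    then have b: "0 < \<Phi> n" "\<Phi> n < 3 * pi"
      using bounds[of "n - 1"] n_facts(1) pos[of "n - 1"] ltpi[of "n - 1"] by force+
    have "v 0 = v 0 * cis (s * \<Phi> n)" using v_period[of 0] v[of n] by simp
    moreover have "v 0 \<noteq> 0" using norm_v[of 0] \<rho> by auto
    ultimately have "cis (s * \<Phi> n) = 1" by simp
    then have "cos (s * \<Phi> n) = 1" by (simp add: complex_eq_iff)
    then have "cos (\<Phi> n) = 1" using s by auto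
    then obtain k :: int where k: "\<Phi> n = of_int k * 2 * pi" by (auto simp: cos_one_2pi_int)
    then have "0 < k" "real_of_int k < 2" using b by (auto simp: zero_less_mult_iff)
    then have "k = 1" by linarith
    with k show ?thesis by simp
  qed
  then show thesis using that[of s \<theta>] s pos ltpi v_Suc \<delta> by (simp add: \<Phi>_def)
qed

text \<open>The rotation sends the vertex list to its cyclic shift. The shifted list has the same
  boundary, so invariance under motions compares neighbouring vertices and sides.\<close>

private lemma hregular_if_rotation:
  assumes \<omega>: "cmod \<omega> = 1" and v: "\<And>i. v (Suc i) = \<omega> * v i"
  shows "hregular P"
proof -
  let ?T = "\<lambda>z. \<omega> * z"
  have T: "hmotion ?T" by (rule hmotion_rotate[OF \<omega>])
  have PD: "set P \<subseteq> hplane" using polygon by (auto simp: hpolygon_def)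
  have map: "map ?T P = rotate1 P"
  proof (rule nth_equalityI)
    fix i assume i: "i < length (map ?T P)"
    then have "?T (P ! i) = v (Suc i)" using v[of i] by (simp add: hvertex_def)
    then show "map ?T P ! i = rotate1 P ! i" using i by (simp add: nth_rotate1 hvertex_def)
  qed simp
  have vr: "hvertex (rotate1 P) i = v (Suc i)" for i
    using n_facts by (simp add: hvertex_def nth_rotate1 mod_Suc_eq)
  have bd: "hboundary (rotate1 P) = hboundary P"
  proof -
    have "hboundary (rotate1 P) = (\<Union>i. hside P (Suc i))"
      using n_facts by (simp add: hboundary_eq_UNIV hside_def vr)
    also have "\<dots> = (\<Union>i. hside P i)"
    proof safe
      fix x i assume "x \<in> hside P i"
      moreover have "hside P i = hside P (Suc (i + (n - 1)))"
        using v_period[of i] v_period[of "Suc i"] n_facts by (simp add: hside_def)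
      ultimately show "x \<in> (\<Union>i. hside P (Suc i))" by auto
    qed auto
    finally show ?thesis using n_facts by (simp add: hboundary_eq_UNIV)
  qed
  have "hinterior_angle P (Suc i) = hinterior_angle P i" for i
  proof -
    have "hinterior_angle P (Suc i) = hinterior_angle (rotate1 P) i"
      by (simp add: hinterior_angle_def hinterior_def bd vr)
    also have "\<dots> = hinterior_angle P i"
      unfolding map[symmetric] by (rule hinterior_angle_map[OF T n_facts(3) PD])
    finally show ?thesis .
  qed
  then have "hinterior_angle P i = hinterior_angle P 0" for i by (induction i) auto
  moreover have "hside_length P (Suc i) = hside_length P i" for i
  proof -
    have "hside_length P (Suc i) = hside_length (rotate1 P) i"
      by (simp add: hside_length_def vr)
    also have "\<dots> = hside_length P i"
      unfolding map[symmetric] by (rule hside_length_map[OF T n_facts(3) PD])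
    finally show ?thesis .
  qed
  then have "hside_length P i = hside_length P 0" for i by (induction i) auto
  ultimately show ?thesis unfolding hregular_def by metis
qed

lemma hperimeter_centered_at_origin:
  assumes R: "\<And>z. z \<in> set P \<Longrightarrow> hdist 0 z = R"
  shows "hperimeter P \<le> 2 * real n * arsinh (sin (pi / real n) * sinh R)"
    and "hperimeter P = 2 * real n * arsinh (sin (pi / real n) * sinh R) \<longleftrightarrow> hregular P"
proof -
  obtain s \<theta> where s: "s = 1 \<or> s = -1" and \<theta>: "\<And>i. 0 < \<theta> i" "\<And>i. \<theta> i < pi"
    and v: "\<And>i. v (Suc i) = v i * cis (s * \<theta> i)" and sum: "(\<Sum>i<n. \<theta> i) = 2 * pi"
    using central_angles by blast
  \<comment> \<open>Side lengths depend on half the central angles, which sum to \<open>pi\<close>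
    as Jensen's inequality requires.\<close>
  define x where "x i = \<theta> i / 2" for i
  have Rv: "hdist 0 (v i) = R" for i using R hvertex_in_set[OF n_facts(3)] by blast
  have S: "0 < sinh R"
    using cosh_sinh_hdist_0(2)[of "v 0"] Rv[of 0] norm_v[of 0] \<rho> by (simp add: abs_square_less_1)
  have x: "0 < x i \<and> x i < pi / 2" for i using \<theta>[of i] by (simp add: x_def)
  have sumx: "(\<Sum>i<n. x i) = pi" using sum by (simp add: x_def flip: sum_divide_distrib)
  have len: "hside_length P i = 2 * arsinh (sinh R * sin (x i))" for i
  proof -
    have "hside_length P i = 2 * arsinh (sinh R * \<bar>sin (s * \<theta> i / 2)\<bar>)"
      unfolding hside_length_def
      by (subst hdist_on_circle[OF norm_v norm_v \<rho>(2) v]) (simp add: Rv)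
    moreover have "0 < sin (x i)" using x[of i] by (intro sin_gt_zero) auto
    then have "\<bar>sin (s * \<theta> i / 2)\<bar> = sin (x i)" using s by (auto simp: x_def)
    ultimately show ?thesis by simp
  qed
  have peri: "hperimeter P = 2 * (\<Sum>i<n. arsinh (sinh R * sin (x i)))"
    by (simp add: hperimeter_def n_facts(2) len sum_distrib_left)
  note jensen = sum_arsinh_sin[OF S n_facts(1) x sumx]
  show "hperimeter P \<le> 2 * real n * arsinh (sin (pi / real n) * sinh R)"
    using jensen(1) by (simp add: peri mult.commute)
  have "hperimeter P = 2 * real n * arsinh (sin (pi / real n) * sinh R) \<longleftrightarrow> (\<forall>i<n. x i = pi / real n)"
    using jensen(2) by (simp add: peri mult.commute)
  also have "\<dots> \<longleftrightarrow> hregular P"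
  proof
    assume eq: "\<forall>i<n. x i = pi / real n"
    define \<omega> where "\<omega> = cis (s * (2 * pi / real n))"
    have step: "v (Suc i) = \<omega> * v i" for i
    proof -
      have "i mod n < n" using n_facts by simp
      then have "\<theta> (i mod n) = 2 * pi / real n" using eq by (auto simp: x_def field_simps)
      then have "v (Suc (i mod n)) = \<omega> * v (i mod n)" using v[of "i mod n"] by (simp add: \<omega>_def)
      then show ?thesis using hvertex_mod[of P i] hvertex_Suc_mod[of P i] n_facts(2) by simp
    qed
    show "hregular P" by (rule hregular_if_rotation[of \<omega>, OF _ step]) (simp add: \<omega>_def)
  next
    assume reg: "hregular P"
    \<comment> \<open>Equal sides have equal sines, and the sine is injective on the range of the
      half angles.\<close>
    have x0: "x i = x 0" if "i < n" for i
    proof -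
      have "i < length P" "0 < length P" using that n_facts(2) by simp_all
      then have "hside_length P i = hside_length P 0" using reg unfolding hregular_def by blast
      then have "arsinh (sinh R * sin (x i)) = arsinh (sinh R * sin (x 0))"
        unfolding len by simp
      then have "sinh R * sin (x i) = sinh R * sin (x 0)" by (metis sinh_arsinh_real)
      then have sin: "sin (x i) = sin (x 0)" using S by simp
      show ?thesis by (rule sin_inj_pi[OF _ _ _ _ sin]) (use x[of i] x[of 0] in linarith)+
    qed
    have "(\<Sum>i<n. x i) = (\<Sum>i<n. x 0)" by (rule sum.cong[OF refl], rule x0) simp
    then have "x 0 = pi / real n" using sumx n_facts by (simp add: field_simps)
    with x0 show "\<forall>i<n. x i = pi / real n" by metis
  qed
  finally show "hperimeter P = 2 * real n * arsinh (sin (pi / real n) * sinh R) \<longleftrightarrow> hregular P" .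
qed

end

section \<open>Uniqueness of the circumcircle and the main theorem\<close>

lemma norm_eq_if_hdist_0_eq:
  assumes "z \<in> hplane" "w \<in> hplane" "hdist 0 z = hdist 0 w"
  shows "cmod z = cmod w"
proof -
  have zw: "cmod z < 1" "cmod w < 1" using assms by (auto simp: hplane_def)
  then have p: "(cmod z)\<^sup>2 < 1" "(cmod w)\<^sup>2 < 1" by (simp_all add: abs_square_less_1)
  have "(1 + (cmod z)\<^sup>2) / (1 - (cmod z)\<^sup>2) = (1 + (cmod w)\<^sup>2) / (1 - (cmod w)\<^sup>2)"
    using cosh_sinh_hdist_0(1)[OF zw(1)] cosh_sinh_hdist_0(1)[OF zw(2)] assms(3) by simp
  then have "(cmod z)\<^sup>2 = (cmod w)\<^sup>2"
    using p by (simp add: frac_eq_eq algebra_simps)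
  then show ?thesis by simp
qed

text \<open>Points equidistant from \<open>0\<close> and from \<open>d\<close> agree in their
  component along \<open>d\<close> and, up to sign, in the one across it. At most two points do so,
  mirror images in the line through the centres.\<close>

lemma circle_center_unique:
  assumes "distinct [a, b, c]" and hp: "{a, b, c} \<subseteq> hplane" "d \<in> hplane"
    and r: "\<And>z. z \<in> {a, b, c} \<Longrightarrow> hdist 0 z = r" and r': "\<And>z. z \<in> {a, b, c} \<Longrightarrow> hdist d z = r'"
  shows "d = 0"
proof (rule ccontr)
  assume d: "d \<noteq> 0"
  have pair: "Re (z * cnj d) = Re (w * cnj d) \<and> (Im (z * cnj d))\<^sup>2 = (Im (w * cnj d))\<^sup>2"
    if zw: "z \<in> {a, b, c}" "w \<in> {a, b, c}" for z w
  proof -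
    have h: "z \<in> hplane" "w \<in> hplane" using zw hp by blast+
    have n: "cmod z = cmod w" using norm_eq_if_hdist_0_eq[OF h] r[OF zw(1)] r[OF zw(2)] by simp
    have l: "cmod d < 1" "cmod z < 1" "cmod w < 1" using h hp by (auto simp: hplane_def)
    then have q: "0 < 1 - (cmod d)\<^sup>2" "0 < 1 - (cmod w)\<^sup>2" by (simp_all add: abs_square_less_1)
    have "1 + 2 * (cmod (d - z))\<^sup>2 / ((1 - (cmod d)\<^sup>2) * (1 - (cmod w)\<^sup>2)) =
        1 + 2 * (cmod (d - w))\<^sup>2 / ((1 - (cmod d)\<^sup>2) * (1 - (cmod w)\<^sup>2))"
      using cosh_hdist(1)[OF l(1,2)] cosh_hdist(1)[OF l(1,3)] r'[OF zw(1)] r'[OF zw(2)] n by simp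
    then have e: "(cmod (d - z))\<^sup>2 = (cmod (d - w))\<^sup>2" using q by simp
    have re: "Re (u * cnj d) = ((cmod d)\<^sup>2 + (cmod u)\<^sup>2 - (cmod (d - u))\<^sup>2) / 2" for u
      unfolding cmod_power2 by (simp add: power2_eq_square algebra_simps)
    have im: "(Im (u * cnj d))\<^sup>2 = (cmod u)\<^sup>2 * (cmod d)\<^sup>2 - (Re (u * cnj d))\<^sup>2" for u
      using cmod_power2[of "u * cnj d"] by (simp only: norm_mult complex_mod_cnj power_mult_distrib)
    have "Re (z * cnj d) = Re (w * cnj d)" unfolding re n e ..
    then show ?thesis using im[of z] im[of w] n by simp
  qed
  have eq: "z = w" if "Re (z * cnj d) = Re (w * cnj d)" "Im (z * cnj d) = Im (w * cnj d)" for z w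
    using complex_eqI[OF that] d by simp
  have "Im (a * cnj d) = Im (b * cnj d) \<or> Im (a * cnj d) = Im (c * cnj d) \<or> Im (b * cnj d) = Im (c * cnj d)"
  proof -
    have "(Im (a * cnj d))\<^sup>2 = (Im (b * cnj d))\<^sup>2" "(Im (a * cnj d))\<^sup>2 = (Im (c * cnj d))\<^sup>2"
      by (rule conjunct2[OF pair]; simp)+
    then show ?thesis unfolding power2_eq_iff by (elim disjE) simp_all
  qed
  moreover have "Re (a * cnj d) = Re (b * cnj d)" "Re (a * cnj d) = Re (c * cnj d)"
    by (rule conjunct1[OF pair]; simp)+
  ultimately show False
    using eq[of a b] eq[of a c] eq[of b c] assms(1) unfolding distinct.simps by (metis list.set_intros)
qed

theorem theorem1p2:
  fixes n :: nat and P :: "complex list"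
  assumes "n \<ge> 3" and "hpolygon n P" and "hcyclic P" and "hcentered P"
  shows "hperimeter P \<le> 2 * real n * arsinh (sin (pi / real n) * sinh (hcircumradius P))
    \<and> (hperimeter P = 2 * real n * arsinh (sin (pi / real n) * sinh (hcircumradius P))
         \<longleftrightarrow> hregular P)"
proof -
  have P: "length P = n" "set P \<subseteq> hplane" "distinct P" "P \<noteq> []"
    using assms(1,2) by (auto simp: hpolygon_def)
  obtain c r where c: "c \<in> hplane" and r: "set P \<subseteq> hcircle c r"
    using assms(3) by (auto simp: hcyclic_def)
  define T where "T = mob (- c)"
  have T: "hmotion T" using c by (simp add: T_def hplane_def hmotion_mob)
  have Tc: "T c = 0" by (simp add: T_def mob_def)
  have TP: "hdist (T d) z = s" if "d \<in> hplane" "set P \<subseteq> hcircle d s" "z \<in> set (map T P)" for d s z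
    using that hdist_hmotion[OF T] by (auto simp: hcircle_def subset_iff)
  have TPh: "set (map T P) \<subseteq> hplane" using hmotion_hplane[OF T] P(2) by auto
  have T_poly: "hpolygon n (map T P)" by (rule hpolygon_map[OF T P(4,2) assms(2)])
  have l: "length (map T P) = n" "distinct (map T P)" using T_poly by (auto simp: hpolygon_def)
  \<comment> \<open>Any rival centre is moved along with the polygon; three of the moved vertices
    then force it to the origin.\<close>
  have uniq: "d = c \<and> s = r" if d: "d \<in> hplane" "set P \<subseteq> hcircle d s" for d s
  proof -
    define x where "x i = map T P ! i" for i
    have xs: "x i \<in> set (map T P)" if "i < 3" for i
      unfolding x_def using that l(1) assms(1) by (intro nth_mem) simp
    have "x i \<noteq> x j" if "i < 3" "j < 3" "i \<noteq> j" for i j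
      unfolding x_def using that l assms(1) by (simp add: nth_eq_iff_index_eq del: nth_map)
    then have dist: "distinct [x 0, x 1, x 2]" by simp
    have sub: "{x 0, x 1, x 2} \<subseteq> set (map T P)" using xs by simp
    have "T d = 0"
    proof (rule circle_center_unique[OF dist])
      show "{x 0, x 1, x 2} \<subseteq> hplane" using sub TPh by (rule subset_trans)
      show "T d \<in> hplane" by (rule hmotion_hplane[OF T d(1)])
      show "hdist 0 z = r" if "z \<in> {x 0, x 1, x 2}" for z
        using TP[OF c r] subsetD[OF sub that] Tc by simp
      show "hdist (T d) z = s" if "z \<in> {x 0, x 1, x 2}" for z
        using TP[OF d] subsetD[OF sub that] by simp
    qed
    then have "d = c" using inj_onD[OF inj_on_hmotion[OF T]] Tc c d(1) by metis
    moreover have "P ! 0 \<in> set P" using P(4) by simp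
    then have "hdist c (P ! 0) = r" "hdist d (P ! 0) = s"
      using r d(2) unfolding hcircle_def by blast+
    ultimately show ?thesis by simp
  qed
  have cc: "hcircumcenter P = c"
    unfolding hcircumcenter_def by (rule the_equality) (use c r uniq in blast)+
  have cr: "hcircumradius P = r"
    unfolding hcircumradius_def by (rule the_equality) (use c r uniq in blast)+
  have "c \<in> hinterior P" using assms(4) cc by (simp add: hcentered_def)
  then have center: "0 \<in> hinterior (map T P)"
    using Tc by (simp add: hinterior_map[OF T P(4,2)] rev_image_eqI)
  define \<rho> where "\<rho> = cmod (map T P ! 0)"
  have x: "map T P ! i \<in> set (map T P)" if "i < 2" for i
    using that l(1) assms(1) by (intro nth_mem) simp
  have hd: "hdist 0 z = r" if "z \<in> set (map T P)" for z
    using TP[OF c r that] Tc by simp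
  have circle: "cmod z = \<rho>" if "z \<in> set (map T P)" for z
    unfolding \<rho>_def using TPh that x[of 0] hd by (intro norm_eq_if_hdist_0_eq) auto
  have "\<rho> < 1" using TPh x[of 0] by (auto simp: \<rho>_def hplane_def)
  moreover have "\<rho> \<noteq> 0"
  proof
    assume "\<rho> = 0"
    then have "map T P ! 0 = map T P ! 1" using circle[OF x[of 0]] circle[OF x[of 1]] by simp
    then show False using l assms(1) by (simp add: nth_eq_iff_index_eq del: nth_map)
  qed
  moreover have "0 \<le> \<rho>" by (simp add: \<rho>_def)
  ultimately have \<rho>: "0 < \<rho>" "\<rho> < 1" by auto
  note res = hperimeter_centered_at_origin[OF T_poly circle \<rho> center hd]
  show ?thesis
    using res by (simp add: cr hperimeter_map[OF T P(4,2)] hregular_map[OF T P(4,2)])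
qed

end
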